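(* Fix $n>1$ and an integer $k\in\{1,\dots,n-1\}$. Let $E_1,\dots,E_n$ be a basis of $\mathfrak{b}\subset\mathfrak{su}(2n+1)$ such that $E_j\in\mathfrak{su}(2n+3-2j)$ for each $j$. Let $A=(a_{ji})\in\mathrm{GL}(n,\mathbb{R})$ satisfy $a_{ji}=0$ whenever $1\le j\le n-k$ and $n-k+1\le i\le n$, and consider $\mathrm{SU}(2n+1)$ with the Joyce hypercomplex structure $(I,J,K)$ corresponding to $A$, i.e. the one associated with the basis $e_1^i=\sum_{j=1}^n a_{ji}E_j$ ($i=1,\dots,n$) of $\mathfrak{b}$; thus $e_1^i=\sum_{j=n-k+1}^n a_{ji}E_j\in\mathfrak{su}(2k+1)$ for $i=n-k+1,\dots,n$. Then the hypercomplex subspace $$\mathfrak{su}(2k+1)=\bigoplus_{i=n-k+1}^n\big(\langle e_1^i\rangle\oplus\mathfrak{d}_i\oplus\mathfrak{f}_i\big)$$ is invariant by the Obata connection $\nabla$ of $(I,J,K)$, i.e. $\nabla_XY\in\mathfrak{su}(2k+1)$ for all $X\in\mathfrak{su}(2n+1)$ and $Y\in\mathfrak{su}(2k+1)$. In particular, $\mathrm{Hol}(\nabla)\subsetneqq\mathrm{GL}(n(n+1),\mathbb{H})$.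
   Context: Elements of a Lie algebra are identified with left-invariant vector fields. $\mathfrak{su}(2n+1)$ is the algebra of trace-free skew-Hermitian $(2n+1)\times(2n+1)$ matrices. For $1\le k\le n$, $\mathfrak{su}(2k+1)\subset\mathfrak{su}(2n+1)$ denotes the subalgebra of matrices supported in the bottom-right square block of size $2k+1$. The Joyce decomposition is $\mathfrak{su}(2n+1)=\mathfrak{b}\oplus\bigoplus_{i=1}^n\mathfrak{d}_i\oplus\bigoplus_{i=1}^n\mathfrak{f}_i$, where: - $\mathfrak{d}_i\cong\mathfrak{su}(2)$ consists of trace-free skew-Hermitian matrices supported in the $2\times2$ diagonal block with rows and columns $2i-1,2i$; - $\mathfrak{f}_i$ consists of the matrices whose only non-zero entries are a $2\times(2n+1-2i)$ complex block $F_i$ in rows $2i-1,2i$ and columns $2i+1,\dots,2n+1$, together with the block $-\bar F_i^{t}$ in the transposed position; - $\mathfrak{b}$ (of dimension $n$) consists of the trace-free skew-Hermitian diagonal matrices commuting with every $\mathfrak{d}_i$. Given a basis $(e_1^1,\dots,e_1^n)$ of $\mathfrak{b}$, choose for each $i$ a basis $(e_2^i,e_3^i,e_4^i)$ of $\mathfrak{d}_i$ with $[e_2^i,e_3^i]=2e_4^i$, $[e_4^i,e_2^i]=2e_3^i$, $[e_3^i,e_4^i]=2e_2^i$. The associated Joyce hypercomplex structure is the left-invariant hypercomplex structure $(I,J,K)$ on $\mathrm{SU}(2n+1)$ with $Ie_1^i=e_2^i$, $Ie_3^i=e_4^i$, $Je_1^i=e_3^i$, $Je_2^i=-e_4^i$,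 $Ke_1^i=e_4^i$, $Ke_2^i=e_3^i$, and $If=[e_2^i,f]$, $Jf=[e_3^i,f]$, $Kf=[e_4^i,f]$ for $f\in\mathfrak{f}_i$. The Obata connection is the unique torsion-free connection $\nabla$ preserving $I,J,K$; its holonomy group $\mathrm{Hol}(\nabla)$ lies in the group of automorphisms of the tangent space at the identity commuting with $I,J,K$, identified with $\mathrm{GL}(n(n+1),\mathbb{H})$. *)

theory Defs
  imports "HOL-Analysis.Analysis"
begin

section \<open>Matrices and the Joyce decomposition\<close>

text \<open>Rows and columns are indexed by a finite linear order \<open>'m\<close>; \<open>pos p \<in> {1..CARD('m)}\<close> is the
  number of the row or column \<open>p\<close>. The statement assumes \<open>CARD('m) = 2 * n + 1\<close>. All linear
  algebra (\<^const>\<open>span\<close>, \<^const>\<open>independent\<close>, \<^const>\<open>subspace\<close>) is over the reals.\<close>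

type_synonym 'm cmat = "((complex, 'm) vec, 'm) vec"

definition pos :: "'m::{finite,linorder} \<Rightarrow> nat" where
  "pos p = card {..p}"

definition conj_transpose :: "'m::finite cmat \<Rightarrow> 'm cmat" where
  "conj_transpose X = map_matrix cnj (transpose X)"

definition SU :: "'m::finite cmat set" where
  "SU = {x. x ** conj_transpose x = mat 1 \<and> det x = 1}"

definition su :: "'m::finite cmat set" where
  "su = {X. conj_transpose X = - X \<and> trace X = 0}"

definition bracket :: "'m::finite cmat \<Rightarrow> 'm cmat \<Rightarrow> 'm cmat" where
  "bracket X Y = X ** Y - Y ** X"

text \<open>\<open>su_block r\<close> is the copy of \<open>su(r)\<close> in the bottom-right square block of size \<open>r\<close>.\<close>

definition su_block :: "nat \<Rightarrow> 'm::{finite,linorder} cmat set" where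
  "su_block r = {X \<in> su. \<forall>p q. X $ p $ q \<noteq> 0 \<longrightarrow>
     CARD('m) < pos p + r \<and> CARD('m) < pos q + r}"

definition joyce_d :: "nat \<Rightarrow> 'm::{finite,linorder} cmat set" where
  "joyce_d i = {X \<in> su. \<forall>p q. X $ p $ q \<noteq> 0 \<longrightarrow>
     pos p \<in> {2*i-1, 2*i} \<and> pos q \<in> {2*i-1, 2*i}}"

definition joyce_f :: "nat \<Rightarrow> 'm::{finite,linorder} cmat set" where
  "joyce_f i = {X. conj_transpose X = - X \<and> (\<forall>p q. X $ p $ q \<noteq> 0 \<longrightarrow>
     (pos p \<in> {2*i-1, 2*i} \<and> pos q \<in> {2*i+1..CARD('m)}) \<or>
     (pos q \<in> {2*i-1, 2*i} \<and> pos p \<in> {2*i+1..CARD('m)}))}"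

definition joyce_b :: "nat \<Rightarrow> 'm::{finite,linorder} cmat set" where
  "joyce_b n = {X \<in> su. (\<forall>p q. p \<noteq> q \<longrightarrow> X $ p $ q = 0) \<and>
     (\<forall>i\<in>{1..n}. \<forall>D\<in>joyce_d i. bracket X D = 0)}"

definition is_basis :: "'v::real_vector set \<Rightarrow> nat set \<Rightarrow> (nat \<Rightarrow> 'v) \<Rightarrow> bool" where
  "is_basis V S e \<longleftrightarrow> inj_on e S \<and> independent (e ` S) \<and> span (e ` S) = V"

text \<open>Internal direct sum \<open>V = \<Oplus>s\<in>S. W s\<close> of real subspaces over a finite index set.\<close>

definition is_direct_sum :: "'v::real_vector set \<Rightarrow> 's set \<Rightarrow> ('s \<Rightarrow> 'v set) \<Rightarrow> bool" where
  "is_direct_sum V S W \<longleftrightarrow>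
     finite S \<and> (\<forall>s\<in>S. subspace (W s)) \<and>
     V = {\<Sum>s\<in>S. w s | w. \<forall>s\<in>S. w s \<in> W s} \<and>
     (\<forall>w. (\<forall>s\<in>S. w s \<in> W s) \<and> (\<Sum>s\<in>S. w s) = 0 \<longrightarrow> (\<forall>s\<in>S. w s = 0))"

definition GL_real :: "nat \<Rightarrow> (nat \<Rightarrow> nat \<Rightarrow> real) \<Rightarrow> bool" where
  "GL_real n a \<longleftrightarrow> (\<exists>c. \<forall>j\<in>{1..n}. \<forall>i\<in>{1..n}.
     (\<Sum>l=1..n. a j l * c l i) = (if j = i then 1 else 0) \<and>
     (\<Sum>l=1..n. c j l * a l i) = (if j = i then 1 else 0))"

section \<open>The Joyce hypercomplex structure\<close>

definition linear_on_su :: "('m::finite cmat \<Rightarrow> 'm cmat) \<Rightarrow> bool" where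
  "linear_on_su T \<longleftrightarrow> (\<forall>X\<in>su. T X \<in> su) \<and>
     (\<forall>X\<in>su. \<forall>Y\<in>su. T (X + Y) = T X + T Y) \<and> (\<forall>(c::real). \<forall>X\<in>su. T (c *\<^sub>R X) = c *\<^sub>R T X)"

definition nijenhuis ::
  "('m::finite cmat \<Rightarrow> 'm cmat) \<Rightarrow> 'm cmat \<Rightarrow> 'm cmat \<Rightarrow> 'm cmat" where
  "nijenhuis T X Y = bracket (T X) (T Y) - T (bracket (T X) Y) - T (bracket X (T Y)) - bracket X Y"

definition complex_structure :: "('m::finite cmat \<Rightarrow> 'm cmat) \<Rightarrow> bool" where
  "complex_structure T \<longleftrightarrow> linear_on_su T \<and> (\<forall>X\<in>su. T (T X) = - X) \<and>
     (\<forall>X\<in>su. \<forall>Y\<in>su. nijenhuis T X Y = 0)"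

text \<open>Left-invariant hypercomplex structures on \<open>SU\<close>, given by their values at the identity.\<close>

definition hypercomplex_structure where
  "hypercomplex_structure I J K \<longleftrightarrow>
     complex_structure I \<and> complex_structure J \<and> complex_structure K \<and>
     (\<forall>X\<in>su. I (J X) = K X \<and> J (I X) = - K X)"

definition joyce_bases ::
  "nat \<Rightarrow> (nat \<Rightarrow> 'm::{finite,linorder} cmat) \<Rightarrow> (nat \<Rightarrow> 'm cmat) \<Rightarrow>
   (nat \<Rightarrow> 'm cmat) \<Rightarrow> (nat \<Rightarrow> 'm cmat) \<Rightarrow> bool" where
  "joyce_bases n e1 e2 e3 e4 \<longleftrightarrow> is_basis (joyce_b n) {1..n} e1 \<and>
     (\<forall>i\<in>{1..n}. distinct [e2 i, e3 i, e4 i] \<and> independent {e2 i, e3 i, e4 i} \<and>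
        span {e2 i, e3 i, e4 i} = joyce_d i \<and>
        bracket (e2 i) (e3 i) = 2 *\<^sub>R e4 i \<and>
        bracket (e4 i) (e2 i) = 2 *\<^sub>R e3 i \<and>
        bracket (e3 i) (e4 i) = 2 *\<^sub>R e2 i)"

definition joyce_hypercomplex ::
  "nat \<Rightarrow> (nat \<Rightarrow> 'm::{finite,linorder} cmat) \<Rightarrow> (nat \<Rightarrow> 'm cmat) \<Rightarrow>
   (nat \<Rightarrow> 'm cmat) \<Rightarrow> (nat \<Rightarrow> 'm cmat) \<Rightarrow>
   ('m cmat \<Rightarrow> 'm cmat) \<Rightarrow> ('m cmat \<Rightarrow> 'm cmat) \<Rightarrow>
   ('m cmat \<Rightarrow> 'm cmat) \<Rightarrow> bool" where
  "joyce_hypercomplex n e1 e2 e3 e4 I J K \<longleftrightarrow>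
     joyce_bases n e1 e2 e3 e4 \<and> hypercomplex_structure I J K \<and>
     (\<forall>i\<in>{1..n}.
        I (e1 i) = e2 i \<and> I (e3 i) = e4 i \<and>
        J (e1 i) = e3 i \<and> J (e2 i) = - e4 i \<and>
        K (e1 i) = e4 i \<and> K (e2 i) = e3 i \<and>
        (\<forall>f\<in>joyce_f i. I f = bracket (e2 i) f \<and> J f = bracket (e3 i) f \<and> K f = bracket (e4 i) f))"

section \<open>The Obata connection\<close>

text \<open>Left translations trivialise the tangent bundle of \<open>SU\<close>, so an affine connection is
  \<open>d + \<Gamma>\<close>, where \<open>\<Gamma> x X Y \<in> su\<close> is the value at \<open>x\<close> of \<open>\<nabla>\<^sub>X Y\<close> for the left-invariant fields
  \<open>X\<close> and \<open>Y\<close>. Left-invariance of the connection itself, i.e. independence of \<open>x\<close>, is not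
  assumed, and neither is regularity in \<open>x\<close>: both follow from \<open>obata_connection\<close>, which has at most
  one solution at each \<open>x\<close> (for two solutions, the difference \<open>S\<close> is symmetric and \<open>I\<close>-,
  \<open>J\<close>-linear in each argument, so \<open>I (J (S X Y)) = S (I X) (J Y) = J (I (S X Y))\<close>).\<close>

definition affine_connection ::
  "('m::finite cmat \<Rightarrow> 'm cmat \<Rightarrow> 'm cmat \<Rightarrow> 'm cmat) \<Rightarrow> bool" where
  "affine_connection \<Gamma> \<longleftrightarrow>
     (\<forall>x\<in>SU. (\<forall>X\<in>su. linear_on_su (\<Gamma> x X)) \<and> (\<forall>Y\<in>su. linear_on_su (\<lambda>X. \<Gamma> x X Y)))"

definition torsion_free where
  "torsion_free \<Gamma> \<longleftrightarrow> (\<forall>x\<in>SU. \<forall>X\<in>su. \<forall>Y\<in>su. \<Gamma> x X Y - \<Gamma> x Y X = bracket X Y)"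

definition preserves where
  "preserves \<Gamma> T \<longleftrightarrow> (\<forall>x\<in>SU. \<forall>X\<in>su. \<forall>Y\<in>su. \<Gamma> x X (T Y) = T (\<Gamma> x X Y))"

definition obata_connection where
  "obata_connection I J K \<Gamma> \<longleftrightarrow> affine_connection \<Gamma> \<and> torsion_free \<Gamma> \<and>
     preserves \<Gamma> I \<and> preserves \<Gamma> J \<and> preserves \<Gamma> K"

section \<open>Holonomy\<close>

text \<open>The derivative is required to be continuous up to the end points of each piece; this is
  stronger than \<^const>\<open>valid_path\<close>, which allows an unbounded derivative near a break point.\<close>

definition piecewise_C1 :: "(real \<Rightarrow> 'v::real_normed_vector) \<Rightarrow> bool" where
  "piecewise_C1 g \<longleftrightarrow> (\<exists>(m::nat) \<tau>. \<tau> 0 = 0 \<and> \<tau> m = 1 \<and>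
     (\<forall>i<m. \<tau> i < \<tau> (Suc i) \<and>
        (\<exists>D. continuous_on {\<tau> i..\<tau> (Suc i)} D \<and>
           (\<forall>t\<in>{\<tau> i..\<tau> (Suc i)}. (g has_vector_derivative D t) (at t within {\<tau> i..\<tau> (Suc i)})))))"

text \<open>\<open>Y\<close> represents the vector field \<open>t \<mapsto> g t ** Y t\<close> along \<open>g\<close>, and
  \<open>matrix_inv (g t) ** g' t\<close> is the left-trivialised velocity. The equation
  \<open>Y' + \<Gamma> (g\<^sup>-\<^sup>1 g') Y = 0\<close> is imposed away from finitely many parameters.\<close>

definition parallel_along where
  "parallel_along \<Gamma> g Y \<longleftrightarrow> continuous_on {0..1} Y \<and> (\<forall>t\<in>{0..1}. Y t \<in> su) \<and>
     (\<exists>S. finite S \<and> (\<forall>t\<in>{0<..<1} - S. g differentiable (at t) \<and>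
        (Y has_vector_derivative
           - \<Gamma> (g t) (matrix_inv (g t) ** vector_derivative g (at t)) (Y t)) (at t)))"

text \<open>The holonomy group at the identity. Its elements, and those of \<open>GL_H\<close>, are maps of
  \<^const>\<open>su\<close>, hence the extensional function space.\<close>

definition holonomy ::
  "('m::finite cmat \<Rightarrow> 'm cmat \<Rightarrow> 'm cmat \<Rightarrow> 'm cmat) \<Rightarrow>
   ('m cmat \<Rightarrow> 'm cmat) set" where
  "holonomy \<Gamma> = {P \<in> su \<rightarrow>\<^sub>E su. \<exists>g. piecewise_C1 g \<and> g ` {0..1} \<subseteq> SU \<and> g 0 = mat 1 \<and> g 1 = mat 1 \<and>
     (\<forall>v\<in>su. \<exists>Y. parallel_along \<Gamma> g Y \<and> Y 0 = v \<and> Y 1 = P v)}"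

text \<open>The automorphisms of the tangent space at the identity commuting with \<open>I\<close>, \<open>J\<close>, \<open>K\<close>: since
  \<^const>\<open>su\<close> has real dimension \<open>4 * n * (n + 1)\<close>, this is \<open>GL(n(n+1), H)\<close>.\<close>

definition GL_H ::
  "('m::finite cmat \<Rightarrow> 'm cmat) \<Rightarrow> ('m cmat \<Rightarrow> 'm cmat) \<Rightarrow>
   ('m cmat \<Rightarrow> 'm cmat) \<Rightarrow> ('m cmat \<Rightarrow> 'm cmat) set" where
  "GL_H I J K = {P \<in> su \<rightarrow>\<^sub>E su. linear_on_su P \<and> bij_betw P su su \<and>
     (\<forall>X\<in>su. P (I X) = I (P X) \<and> P (J X) = J (P X) \<and> P (K X) = K (P X))}"

end

theory Submission
  imports Defs
begin

text \<open>Torsion-freeness and parallelism of \<open>I\<close>, \<open>J\<close>, \<open>K\<close> force the value of the Obata connection at every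
  point to be \<open>2 \<nabla>\<^sub>X Y = [X,Y] + I[IX,Y] - J[X,JY] + K[IX,JY]\<close>. Write \<open>h = su(2k+1)\<close>. If \<open>X\<close> and
  \<open>IX\<close> normalise \<open>h\<close>, as for \<open>X\<close> in \<open>h\<close>, \<open>b\<close> or some \<open>d\<^sub>i\<close>, then \<open>\<nabla>\<^sub>X\<close> preserves \<open>h\<close>; for \<open>X\<close> in
  \<open>f\<^sub>i\<close> with \<open>i \<le> n - k\<close> the Jacobi identity gives \<open>[IX,Y] = I[X,Y]\<close> for \<open>Y\<close> in \<open>h\<close>, and
  \<open>\<nabla>\<^sub>X Y = 0\<close>. Hence parallel transport descends to the quotient by \<open>h\<close>, and by a Gronwall estimate
  there (no existence theorem is needed) the holonomy preserves \<open>h\<close>. A quaternionic transvection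
  sending \<open>e\<^sub>1\<^sup>n\<close> in \<open>h\<close> to \<open>e\<^sub>1\<^sup>n + e\<^sub>1\<^sup>1\<close>, which is not in \<open>h\<close>, shows that the inclusion is proper.\<close>

section \<open>Blocks of indices and matrix algebra\<close>

text \<open>Rows \<open>2i-1\<close> and \<open>2i\<close> form block \<open>i\<close>; row \<open>2n+1\<close> alone is block \<open>n+1\<close>.\<close>

definition blk :: "'m::{finite,linorder} \<Rightarrow> nat" where
  "blk p = (pos p + 1) div 2"

lemma pos_bij: "bij_betw (pos :: 'm::{finite,linorder} \<Rightarrow> nat) UNIV {1..CARD('m)}"
proof -
  have "strict_mono (pos :: 'm \<Rightarrow> nat)"
    unfolding pos_def by (intro strict_monoI psubset_card_mono) auto
  then have inj: "inj (pos :: 'm \<Rightarrow> nat)"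
    by (rule strict_mono_imp_inj_on)
  have "card {..p} > 0" for p :: 'm
    by (auto simp: card_gt_0_iff)
  moreover have "card {..p} \<le> CARD('m)" for p :: 'm
    by (intro card_mono) auto
  ultimately have "range (pos :: 'm \<Rightarrow> nat) \<subseteq> {1..CARD('m)}"
    by (auto simp: pos_def Suc_le_eq)
  moreover have "card (range (pos :: 'm \<Rightarrow> nat)) = card {1..CARD('m)}"
    using inj by (simp add: card_image)
  ultimately have "range (pos :: 'm \<Rightarrow> nat) = {1..CARD('m)}"
    by (intro card_subset_eq) auto
  with inj show ?thesis by (simp add: bij_betw_def)
qed

lemma pos_eq_iff: "pos p = pos q \<longleftrightarrow> p = q"
  using pos_bij by (auto simp: bij_betw_def dest: injD)

lemma pos_bounds: "1 \<le> pos (p :: 'm::{finite,linorder})" "pos p \<le> CARD('m)"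
  using pos_bij[where 'm='m] by (auto simp: bij_betw_def)

lemma blk_eq_iff: "1 \<le> i \<Longrightarrow> blk p = i \<longleftrightarrow> pos p \<in> {2*i-1, 2*i}"
  by (auto simp: blk_def)

lemma blk_gt_iff: "i < blk p \<longleftrightarrow> 2*i < pos p"
  by (auto simp: blk_def)

lemma blk_pos: "1 \<le> blk p"
  using pos_bounds(1)[of p] by (auto simp: blk_def)

lemma blk_le:
  assumes "CARD('m::{finite,linorder}) = 2*n+1"
  shows "blk (p::'m) \<le> n+1"
  using pos_bounds(2)[of p] assms by (auto simp: blk_def)

lemma blk_last_unique:
  assumes "CARD('m::{finite,linorder}) = 2*n+1" "blk (p::'m) = n+1" "blk q = n+1"
  shows "p = q"
proof -
  have "pos p = 2*n+1" "pos q = 2*n+1"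
    using pos_bounds(2)[of p] pos_bounds(2)[of q] assms by (auto simp: blk_def)
  then show ?thesis using pos_eq_iff by metis
qed

lemma blk_last_exists:
  assumes "CARD('m::{finite,linorder}) = 2*n+1"
  obtains l :: "'m::{finite,linorder}" where "blk l = n+1"
proof -
  have "2*n+1 \<in> pos ` (UNIV :: 'm set)"
    using pos_bij[where 'm='m] assms by (simp add: bij_betw_def)
  then obtain l :: 'm where "pos l = 2*n+1" by auto
  then show ?thesis by (intro that[of l]) (auto simp: blk_def)
qed

lemma matrix_mult_nonzero:
  fixes A B :: "'m::finite cmat"
  assumes "(A ** B) $ p $ q \<noteq> 0"
  obtains r where "A $ p $ r \<noteq> 0" "B $ r $ q \<noteq> 0"
proof -
  have "\<exists>r. A $ p $ r * B $ r $ q \<noteq> 0"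
    using assms sum.not_neutral_contains_not_neutral
    by (fastforce simp: matrix_matrix_mult_def)
  then show ?thesis using that by auto
qed

lemma conj_transpose_nth [simp]: "conj_transpose X $ p $ q = cnj (X $ q $ p)"
  by (simp add: conj_transpose_def map_matrix_def transpose_def)

lemma conj_transpose_mult: "conj_transpose (X ** Y) = conj_transpose Y ** conj_transpose X"
  by (auto simp: vec_eq_iff matrix_matrix_mult_def mult.commute)

lemma conj_transpose_add: "conj_transpose (X + Y) = conj_transpose X + conj_transpose Y"
  by (simp add: vec_eq_iff)

lemma conj_transpose_diff: "conj_transpose (X - Y) = conj_transpose X - conj_transpose Y"
  by (simp add: vec_eq_iff)

lemma conj_transpose_scaleR: "conj_transpose (c *\<^sub>R X) = c *\<^sub>R conj_transpose X"
  by (simp add: vec_eq_iff)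

lemma linear_conj_transpose: "linear (conj_transpose :: 'm::finite cmat \<Rightarrow> _)"
  by (intro linearI conj_transpose_add conj_transpose_scaleR)

lemma trace_scaleR: "trace (c *\<^sub>R X) = c *\<^sub>R trace (X :: 'm::finite cmat)"
  by (simp add: trace_def scaleR_sum_right)

lemma subspace_skew: "subspace {X :: 'm::finite cmat. conj_transpose X = - X}"
  by (auto simp: subspace_def vec_eq_iff)

lemma subspace_trace0: "subspace {X :: 'm::finite cmat. trace X = 0}"
  by (auto simp: subspace_def trace_add trace_scaleR) (simp add: trace_def)

lemma subspace_support: "subspace {X :: 'm::finite cmat. \<forall>p q. X $ p $ q \<noteq> 0 \<longrightarrow> R p q}"
proof -
  have "{X :: 'm cmat. \<forall>p q. X $ p $ q \<noteq> 0 \<longrightarrow> R p q} = {X. \<forall>p q. \<not> R p q \<longrightarrow> X $ p $ q = 0}"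
    by auto
  then show ?thesis by (auto simp: subspace_def)
qed

lemma subspace_su: "subspace (su :: 'm::finite cmat set)"
  using subspace_inter[OF subspace_skew subspace_trace0]
  by (simp add: su_def Collect_conj_eq)

lemma subspace_su_support:
  "subspace {X \<in> (su :: 'm::finite cmat set). \<forall>p q. X $ p $ q \<noteq> 0 \<longrightarrow> R p q}"
  using subspace_inter[OF subspace_su subspace_support[of R]]
  by (simp add: Collect_conj_eq)

lemma subspace_su_block: "subspace (su_block r :: 'm::{finite,linorder} cmat set)"
  unfolding su_block_def by (rule subspace_su_support)

lemma subspace_joyce_d: "subspace (joyce_d i :: 'm::{finite,linorder} cmat set)"
  unfolding joyce_d_def by (rule subspace_su_support)

lemma subspace_joyce_f: "subspace (joyce_f i :: 'm::{finite,linorder} cmat set)"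
  unfolding joyce_f_def Collect_conj_eq
  by (intro subspace_inter subspace_skew subspace_support)

lemma bracket_skew:
  assumes "conj_transpose X = - X" "conj_transpose Y = - Y"
  shows "conj_transpose (bracket X Y) = - bracket X Y"
proof -
  have neg: "(- A) ** (- B) = A ** B" for A B :: "'a cmat"
    by (simp add: vec_eq_iff matrix_matrix_mult_def)
  show ?thesis
    by (simp add: bracket_def conj_transpose_diff conj_transpose_mult assms neg)
qed

lemma bracket_su:
  assumes "X \<in> su" "Y \<in> su"
  shows "bracket X Y \<in> su"
  using assms bracket_skew[of X Y] trace_mul_sym[of X Y] by (auto simp: su_def bracket_def trace_sub)

lemma linear_bracket_left: "linear (\<lambda>X :: 'm::finite cmat. bracket X Y)"
  by (rule linearI) (auto simp: bracket_def vec_eq_iff matrix_matrix_mult_def algebra_simps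
      sum.distrib scaleR_sum_right sum_subtractf)

lemma bracket_antisym: "bracket X Y = - bracket Y X"
  by (simp add: bracket_def)

lemma linear_bracket_right: "linear (bracket (X :: 'm::finite cmat))"
  using linear_compose_neg[OF linear_bracket_left[of X]]
  by (simp add: bracket_antisym[of _ X])

lemma bracket_jacobi:
  "bracket (bracket A X) Y = bracket A (bracket X Y) - bracket X (bracket A Y)"
proof -
  have "bracket A (B - C) = bracket A B - bracket A C" 
       "bracket (B - C) A = bracket B A - bracket C A" for A B C :: "'a cmat"
    by (simp_all add: linear_diff[OF linear_bracket_right] linear_diff[OF linear_bracket_left])
  then have "bracket (bracket A X) Y = bracket (A ** X) Y - bracket (X ** A) Y"
    "bracket A (bracket X Y) = bracket A (X ** Y) - bracket A (Y ** X)"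
    "bracket X (bracket A Y) = bracket X (A ** Y) - bracket X (Y ** A)"
    by (simp_all add: bracket_def)
  then show ?thesis by (simp add: bracket_def matrix_mul_assoc)
qed

section \<open>The Joyce summands in terms of blocks\<close>

lemma su_block_iff:
  fixes X :: "'m::{finite,linorder} cmat"
  assumes "CARD('m) = 2*n+1" "k \<le> n"
  shows "X \<in> su_block (2*k+1) \<longleftrightarrow> X \<in> su \<and> (\<forall>p q. X $ p $ q \<noteq> 0 \<longrightarrow> n-k < blk p \<and> n-k < blk q)"
proof -
  have "CARD('m) < pos p + (2*k+1) \<longleftrightarrow> n-k < blk p" for p :: 'm
    unfolding blk_gt_iff using assms by auto
  then show ?thesis by (simp add: su_block_def)
qed

lemma su_block_full:
  assumes "CARD('m::{finite,linorder}) = 2*n+1"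
  shows "su_block (2*n+1) = (su :: 'm cmat set)"
proof -
  have "0 < blk p" for p :: 'm using blk_pos[of p] by linarith
  then show ?thesis using su_block_iff[OF assms, of n] by auto
qed

lemma joyce_d_iff:
  "1 \<le> i \<Longrightarrow> X \<in> joyce_d i \<longleftrightarrow> X \<in> su \<and> (\<forall>p q. X $ p $ q \<noteq> 0 \<longrightarrow> blk p = i \<and> blk q = i)"
  by (simp add: joyce_d_def blk_eq_iff)

lemma joyce_f_iff:
  assumes "1 \<le> i"
  shows "X \<in> joyce_f i \<longleftrightarrow> conj_transpose X = - X \<and> (\<forall>p q. X $ p $ q \<noteq> 0 \<longrightarrow>
    (blk p = i \<and> i < blk q) \<or> (blk q = i \<and> i < blk p))"
  using pos_bounds(2) assms
  by (auto simp: joyce_f_def blk_eq_iff blk_gt_iff Suc_le_eq)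

lemma joyce_f_su:
  assumes "1 \<le> i" "X \<in> joyce_f i"
  shows "X \<in> su"
proof -
  have "X $ p $ p = 0" for p
    using assms by (auto simp: joyce_f_iff)
  then show ?thesis using assms by (simp add: joyce_f_iff su_def trace_def)
qed

lemma off_diagonal_su:
  fixes p q :: "'m::finite"
  assumes "p \<noteq> q"
  shows "(\<chi> r s. if r = p \<and> s = q then 1 else if r = q \<and> s = p then -1 else 0) \<in> (su :: 'm cmat set)"
proof -
  let ?D = "(\<chi> r s. if r = p \<and> s = q then 1 else if r = q \<and> s = p then -1 else 0) :: 'm cmat"
  have "?D $ r $ r = 0" for r
    using assms by simp
  moreover have "cnj (?D $ s $ r) = - ?D $ r $ s" for r s
    using assms by simp
  ultimately show ?thesis
    unfolding su_def trace_def mem_Collect_eq vec_eq_iff by simp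
qed

lemma joyce_b_iff:
  fixes X :: "'m::{finite,linorder} cmat"
  assumes card: "CARD('m) = 2*n+1"
  shows "X \<in> joyce_b n \<longleftrightarrow> X \<in> su \<and> (\<forall>p q. p \<noteq> q \<longrightarrow> X $ p $ q = 0) \<and>
    (\<forall>p q. blk p = blk q \<longrightarrow> X $ p $ p = X $ q $ q)"
proof -
  have diag: "bracket X D $ p $ q = (X $ p $ p - X $ q $ q) * D $ p $ q"
    if "\<forall>p q. p \<noteq> q \<longrightarrow> X $ p $ q = 0" for D :: "'m cmat" and p q
  proof -
    have "(\<Sum>r\<in>UNIV. X $ p $ r * D $ r $ q) = (\<Sum>r\<in>UNIV. if p = r then X $ p $ p * D $ p $ q else 0)"
      using that by (intro sum.cong) auto
    moreover have "(\<Sum>r\<in>UNIV. D $ p $ r * X $ r $ q) = (\<Sum>r\<in>UNIV. if r = q then X $ q $ q * D $ p $ q else 0)"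
      using that by (intro sum.cong) auto
    ultimately show ?thesis
      by (simp add: bracket_def matrix_matrix_mult_def left_diff_distrib)
  qed
  show ?thesis
  proof (intro iffI conjI allI impI)
    fix p q :: 'm assume X: "X \<in> joyce_b n" and eq: "blk p = blk q"
    show "X $ p $ p = X $ q $ q"
    proof (cases "p = q")
      case False
      then have "blk p \<noteq> n+1" using blk_last_unique[OF card] eq by auto
      then have i: "blk p \<in> {1..n}" using blk_le[OF card, of p] blk_pos[of p] by auto
      let ?D = "(\<chi> r s. if r = p \<and> s = q then 1 else if r = q \<and> s = p then -1 else 0) :: 'm cmat"
      have "?D \<in> joyce_d (blk p)"
        unfolding joyce_d_iff[OF blk_pos] using off_diagonal_su[OF False] eq
        by (simp split: if_splits)
      then have "bracket X ?D = 0" using X i by (auto simp: joyce_b_def)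
      moreover have "bracket X ?D $ p $ q = (X $ p $ p - X $ q $ q) * ?D $ p $ q"
        using X by (intro diag) (auto simp: joyce_b_def)
      ultimately show ?thesis by simp
    qed simp
  next
    assume R: "X \<in> su \<and> (\<forall>p q. p \<noteq> q \<longrightarrow> X $ p $ q = 0) \<and>
      (\<forall>p q. blk p = blk q \<longrightarrow> X $ p $ p = X $ q $ q)"
    have "bracket X D = 0" if "i \<in> {1..n}" "D \<in> joyce_d i" for i D
    proof -
      have "(X $ p $ p - X $ q $ q) * D $ p $ q = 0" for p q
      proof (cases "D $ p $ q = 0")
        case False
        then have "blk p = blk q" using that joyce_d_iff[of i D] by simp
        then have "X $ p $ p = X $ q $ q" using R by blast
        then show ?thesis by simp
      qed simp
      moreover have "bracket X D $ p $ q = (X $ p $ p - X $ q $ q) * D $ p $ q" for p q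
        using R by (intro diag) blast
      ultimately show ?thesis unfolding vec_eq_iff by simp
    qed
    then show "X \<in> joyce_b n" using R unfolding joyce_b_def by blast
  qed (auto simp: joyce_b_def)
qed

lemma subspace_joyce_b:
  assumes card: "CARD('m::{finite,linorder}) = 2*n+1"
  shows "subspace (joyce_b n :: 'm cmat set)"
proof -
  have "joyce_b n = su \<inter> {X :: 'm cmat. \<forall>p q. p \<noteq> q \<longrightarrow> X $ p $ q = 0} \<inter>
    {X. \<forall>p q. blk p = blk q \<longrightarrow> X $ p $ p = X $ q $ q}"
    by (rule set_eqI) (simp only: joyce_b_iff[OF card] Int_iff mem_Collect_eq conj_assoc)
  moreover have "subspace {X :: 'm cmat. \<forall>p q. blk p = blk q \<longrightarrow> X $ p $ p = X $ q $ q}"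
    unfolding subspace_def mem_Collect_eq
  proof (intro conjI ballI allI impI)
    fix X Y :: "'m cmat" and p q :: 'm
    assume "X \<in> {X. \<forall>p q. blk p = blk q \<longrightarrow> X $ p $ p = X $ q $ q}"
      "Y \<in> {X. \<forall>p q. blk p = blk q \<longrightarrow> X $ p $ p = X $ q $ q}" "blk p = blk q"
    then have "X $ p $ p = X $ q $ q" "Y $ p $ p = Y $ q $ q" by blast+
    then show "(X + Y) $ p $ p = (X + Y) $ q $ q" by simp
  next
    fix X :: "'m cmat" and c and p q :: 'm
    assume "X \<in> {X. \<forall>p q. blk p = blk q \<longrightarrow> X $ p $ p = X $ q $ q}" "blk p = blk q"
    then have "X $ p $ p = X $ q $ q" by blast
    then show "(c *\<^sub>R X) $ p $ p = (c *\<^sub>R X) $ q $ q" by simp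
  qed simp
  moreover have "subspace {X :: 'm cmat. \<forall>p q. p \<noteq> q \<longrightarrow> X $ p $ q = 0}"
    by (simp add: subspace_def)
  ultimately show ?thesis
    by (simp only: subspace_inter subspace_su)
qed

section \<open>Projections onto the Joyce summands\<close>

definition block_avg :: "nat \<Rightarrow> 'm::{finite,linorder} cmat \<Rightarrow> complex" where
  "block_avg i X = (\<Sum>r | blk r = i. X $ r $ r) / of_nat (card {r :: 'm. blk r = i})"

definition proj_b :: "'m::{finite,linorder} cmat \<Rightarrow> 'm cmat" where
  "proj_b X = (\<chi> p q. if p = q then block_avg (blk p) X else 0)"

definition proj_d :: "nat \<Rightarrow> 'm::{finite,linorder} cmat \<Rightarrow> 'm cmat" where
  "proj_d i X = (\<chi> p q. if blk p = i \<and> blk q = i then (X - proj_b X) $ p $ q else 0)"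

definition proj_f :: "nat \<Rightarrow> 'm::{finite,linorder} cmat \<Rightarrow> 'm cmat" where
  "proj_f i X = (\<chi> p q. if blk p \<noteq> blk q \<and> min (blk p) (blk q) = i then X $ p $ q else 0)"

lemma block_avg_add: "block_avg i (X + Y) = block_avg i X + block_avg i Y"
  by (simp add: block_avg_def sum.distrib add_divide_distrib)

lemma block_avg_scaleR: "block_avg i (c *\<^sub>R X) = c *\<^sub>R block_avg i X"
  by (simp add: block_avg_def scaleR_sum_right[symmetric] divide_inverse)

lemma linear_proj_b: "linear proj_b"
  by (rule linearI) (auto simp: proj_b_def vec_eq_iff block_avg_add block_avg_scaleR)

lemma linear_proj_d: "linear (proj_d i)"
  by (rule linearI) (auto simp: proj_d_def vec_eq_iff linear_add[OF linear_proj_b]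
      linear_scale[OF linear_proj_b] scaleR_diff_right)

lemma linear_proj_f: "linear (proj_f i)"
  by (rule linearI) (auto simp: proj_f_def vec_eq_iff)

lemma block_avg_sum:
  fixes X :: "'m::{finite,linorder} cmat"
  shows "(\<Sum>p :: 'm | blk p = i. block_avg (blk p) X) = (\<Sum>p | blk p = i. X $ p $ p)"
proof (cases "{r :: 'm. blk r = i} = {}")
  case False
  then have "card {r :: 'm. blk r = i} \<noteq> 0" by (simp add: card_eq_0_iff)
  moreover have "(\<Sum>p :: 'm | blk p = i. block_avg (blk p) X) = (\<Sum>p :: 'm | blk p = i. block_avg i X)"
    by (rule sum.cong[OF refl]) auto
  ultimately show ?thesis by (simp add: block_avg_def)
next
  case True
  show ?thesis by (simp only: True sum.empty)
qed

lemma trace_proj_b: "trace (proj_b X) = trace X"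
proof -
  have grp: "(\<Sum>p\<in>UNIV. g p) = (\<Sum>i\<in>range (blk :: 'a \<Rightarrow> nat). \<Sum>p | blk p = i. g p)" for g :: "'a \<Rightarrow> complex"
    using sum.group[of "UNIV :: 'a set" "range (blk :: 'a \<Rightarrow> nat)" blk g] by simp
  show ?thesis
    by (simp add: trace_def proj_b_def grp block_avg_sum del: sum_constant cong: sum.cong)
qed

lemma proj_b_skew:
  assumes "conj_transpose X = - X"
  shows "conj_transpose (proj_b X) = - proj_b X"
proof -
  have "cnj (X $ p $ p) = - X $ p $ p" for p
    using assms by (metis conj_transpose_nth vector_uminus_component)
  then have "cnj (block_avg i X) = - block_avg i X" for i
    by (simp add: block_avg_def sum_negf)
  then show ?thesis by (simp add: vec_eq_iff proj_b_def)
qed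

lemma proj_b_in:
  fixes X :: "'m::{finite,linorder} cmat"
  assumes "CARD('m) = 2*n+1" "X \<in> su"
  shows "proj_b X \<in> joyce_b n"
proof -
  have "proj_b X \<in> su"
    using assms(2) by (simp add: su_def proj_b_skew trace_proj_b)
  then show ?thesis
    unfolding joyce_b_iff[OF assms(1)] by (simp add: proj_b_def)
qed

lemma proj_d_in:
  assumes "1 \<le> i" "X \<in> su"
  shows "proj_d i X \<in> joyce_d i"
proof -
  have skew: "conj_transpose (X - proj_b X) = - (X - proj_b X)"
    using assms(2) by (simp add: su_def proj_b_skew conj_transpose_diff)
  have "cnj ((X - proj_b X) $ q $ p) = - (X - proj_b X) $ p $ q" for p q
    using skew by (metis conj_transpose_nth vector_uminus_component)
  then have "conj_transpose (proj_d i X) = - proj_d i X"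
    unfolding vec_eq_iff proj_d_def by (auto simp del: vector_minus_component)
  moreover have "trace (proj_d i X) = (\<Sum>p | blk p = i. X $ p $ p - block_avg (blk p) X)"
    unfolding trace_def proj_d_def by (simp add: proj_b_def sum.If_cases cong: if_cong)
  then have "trace (proj_d i X) = 0"
    by (simp only: sum_subtractf block_avg_sum diff_self)
  ultimately show ?thesis
    unfolding joyce_d_iff[OF assms(1)] su_def by (simp add: proj_d_def)
qed

lemma proj_f_in:
  assumes "1 \<le> i" "X \<in> su"
  shows "proj_f i X \<in> joyce_f i"
proof -
  have "cnj (X $ q $ p) = - X $ p $ q" for p q
    using assms(2) by (simp add: su_def vec_eq_iff)
  then have "conj_transpose (proj_f i X) = - proj_f i X"
    unfolding vec_eq_iff proj_f_def by (auto simp: min.commute)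
  then show ?thesis
    unfolding joyce_f_iff[OF assms(1)] by (auto simp: proj_f_def min_def)
qed

lemma proj_sum:
  fixes X :: "'m::{finite,linorder} cmat"
  assumes card: "CARD('m) = 2*n+1"
  shows "X = proj_b X + (\<Sum>i=1..n. proj_d i X + proj_f i X)"
proof -
  have "X $ p $ q = proj_b X $ p $ q + (\<Sum>i=1..n. proj_d i X $ p $ q + proj_f i X $ p $ q)" for p q
  proof (cases "blk p = blk q")
    case True
    have "(\<Sum>i=1..n. proj_d i X $ p $ q + proj_f i X $ p $ q)
        = (\<Sum>i=1..n. if i = blk p then (X - proj_b X) $ p $ q else 0)"
      using True by (intro sum.cong) (auto simp: proj_d_def proj_f_def)
    also have "\<dots> = (if blk p \<in> {1..n} then (X - proj_b X) $ p $ q else 0)"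
      by simp
    also have "\<dots> = (X - proj_b X) $ p $ q"
    proof (cases "blk p \<in> {1..n}")
      case False
      then have p: "blk p = n+1" using blk_pos[of p] blk_le[OF card, of p] by simp
      then have "p = q" using True blk_last_unique[OF card] by simp
      moreover have "{r :: 'm. blk r = n+1} = {p}" using p blk_last_unique[OF card] by blast
      then have "block_avg (n+1) X = X $ p $ p" by (simp add: block_avg_def)
      ultimately show ?thesis using p by (simp add: proj_b_def)
    qed simp
    finally show ?thesis by simp
  next
    case False
    have "(\<Sum>i=1..n. proj_d i X $ p $ q + proj_f i X $ p $ q)
        = (\<Sum>i=1..n. if i = min (blk p) (blk q) then X $ p $ q else 0)"
      using False by (intro sum.cong) (auto simp: proj_d_def proj_f_def)
    also have "min (blk p) (blk q) \<in> {1..n}"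
      using False blk_pos[of p] blk_le[OF card, of p] blk_pos[of q] blk_le[OF card, of q] by auto
    then have "(\<Sum>i=1..n. if i = min (blk p) (blk q) then X $ p $ q else 0) = X $ p $ q"
      by simp
    moreover have "proj_b X $ p $ q = 0" using False by (auto simp: proj_b_def)
    ultimately show ?thesis by simp
  qed
  then show ?thesis by (simp add: vec_eq_iff)
qed

context
  fixes n :: nat and B :: "'m::{finite,linorder} cmat"
  assumes card: "CARD('m) = 2*n+1" and B: "B \<in> joyce_b n"
begin

lemma proj_b_b: "proj_b B = B"
proof -
  have "block_avg (blk p) B = B $ p $ p" for p
  proof -
    have "(\<Sum>r | blk r = blk p. B $ r $ r) = (\<Sum>r :: 'm | blk r = blk p. B $ p $ p)"
    proof (rule sum.cong[OF refl])
      fix r :: 'm assume "r \<in> {r. blk r = blk p}"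
      then show "B $ r $ r = B $ p $ p"
        using joyce_b_iff[OF card, THEN iffD1, OF B] by blast
    qed
    then have "block_avg (blk p) B = (\<Sum>r :: 'm | blk r = blk p. B $ p $ p) / of_nat (card {r :: 'm. blk r = blk p})"
      by (simp only: block_avg_def)
    moreover have "{r :: 'm. blk r = blk p} \<noteq> {}" by blast
    then have "card {r :: 'm. blk r = blk p} \<noteq> 0" by (simp add: card_eq_0_iff)
    ultimately show ?thesis by simp
  qed
  moreover have "B $ p $ q = 0" if "p \<noteq> q" for p q
    using joyce_b_iff[OF card, THEN iffD1, OF B] that by blast
  ultimately show ?thesis by (simp add: vec_eq_iff proj_b_def)
qed

lemma proj_d_b: "proj_d i B = 0"
  by (simp add: vec_eq_iff proj_d_def proj_b_b)

lemma proj_f_b: "proj_f i B = 0"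
proof -
  have "B $ p $ q = 0" if "blk p \<noteq> blk q" for p q
  proof -
    have "p \<noteq> q" using that by blast
    then show ?thesis using joyce_b_iff[OF card, THEN iffD1, OF B] by blast
  qed
  then show ?thesis by (simp add: vec_eq_iff proj_f_def)
qed

end

context
  fixes i :: nat and D :: "'m::{finite,linorder} cmat"
  assumes i: "1 \<le> i" and D: "D \<in> joyce_d i"
begin

lemma joyce_d_support: "blk p \<noteq> i \<or> blk q \<noteq> i \<Longrightarrow> D $ p $ q = 0"
  using D unfolding joyce_d_iff[OF i] by blast

lemma proj_b_d: "proj_b D = 0"
proof -
  have "(\<Sum>r | blk r = j. D $ r $ r) = 0" for j
  proof (cases "j = i")
    case True
    have "(\<Sum>r | blk r = i. D $ r $ r) = trace D"
      unfolding trace_def by (rule sum.mono_neutral_left) (auto simp: joyce_d_support)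
    then show ?thesis using D True by (simp add: joyce_d_iff[OF i] su_def)
  qed (simp add: joyce_d_support)
  then show ?thesis by (simp add: vec_eq_iff proj_b_def block_avg_def)
qed

lemma proj_d_d: "proj_d j D = (if j = i then D else 0)"
  by (simp add: vec_eq_iff proj_d_def proj_b_d joyce_d_support)

lemma proj_f_d: "proj_f j D = 0"
  by (auto simp: vec_eq_iff proj_f_def joyce_d_support)

end

context
  fixes i :: nat and F :: "'m::{finite,linorder} cmat"
  assumes i: "1 \<le> i" and F: "F \<in> joyce_f i"
begin

lemma joyce_f_support: "blk p = blk q \<or> min (blk p) (blk q) \<noteq> i \<Longrightarrow> F $ p $ q = 0"
  using F[unfolded joyce_f_iff[OF i], THEN conjunct2, rule_format, of p q]
  by (cases "F $ p $ q = 0") auto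

lemma proj_b_f: "proj_b F = 0"
  by (simp add: vec_eq_iff proj_b_def block_avg_def joyce_f_support)

lemma proj_d_f: "proj_d j F = 0"
  by (simp add: vec_eq_iff proj_d_def proj_b_f joyce_f_support)

lemma proj_f_f: "proj_f j F = (if j = i then F else 0)"
  using joyce_f_support by (auto simp: vec_eq_iff proj_f_def)

end

lemma joyce_d_block:
  fixes D :: "'m::{finite,linorder} cmat"
  assumes "CARD('m) = 2*n+1" "k \<le> n" "n-k < i" "D \<in> joyce_d i"
  shows "D \<in> su_block (2*k+1)"
  using assms joyce_d_iff[of i D] unfolding su_block_iff[OF assms(1,2)] by auto

lemma joyce_f_block:
  fixes F :: "'m::{finite,linorder} cmat"
  assumes "CARD('m) = 2*n+1" "k \<le> n" "n-k < i" "F \<in> joyce_f i"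
  shows "F \<in> su_block (2*k+1)"
  using assms joyce_f_iff[of i F] joyce_f_su[of i F] unfolding su_block_iff[OF assms(1,2)]
  by fastforce

context
  fixes n k :: nat and X :: "'m::{finite,linorder} cmat"
  assumes card: "CARD('m) = 2*n+1" and k: "k \<le> n" and X: "X \<in> su_block (2*k+1)"
begin

lemma su_block_support: "blk p \<le> n-k \<or> blk q \<le> n-k \<Longrightarrow> X $ p $ q = 0"
  using X unfolding su_block_iff[OF card k] by (meson leD)

lemma proj_b_block: "proj_b X \<in> su_block (2*k+1)"
proof -
  have "X \<in> su" using X by (simp add: su_block_def)
  then have "proj_b X \<in> su" using proj_b_in[OF card] joyce_b_iff[OF card] by blast
  moreover have "block_avg j X = 0" if "j \<le> n-k" for j
    using that by (simp add: block_avg_def su_block_support)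
  ultimately show ?thesis
    unfolding su_block_iff[OF card k] by (auto simp: proj_b_def not_le[symmetric])
qed

lemma proj_d_block: "j \<le> n-k \<Longrightarrow> proj_d j X = 0"
  by (auto simp: vec_eq_iff proj_d_def proj_b_def block_avg_def su_block_support)

lemma proj_f_block: "j \<le> n-k \<Longrightarrow> proj_f j X = 0"
  by (auto simp: vec_eq_iff proj_f_def su_block_support min_def)

end

section \<open>The decomposition of a block\<close>

lemma basis_mem: "is_basis V S e \<Longrightarrow> i \<in> S \<Longrightarrow> e i \<in> V"
  unfolding is_basis_def by (metis imageI span_base)

lemma basis_span_coeffs:
  assumes "is_basis V S e" "finite S" "T \<subseteq> S" "x \<in> span (e ` T)"
  obtains c where "x = (\<Sum>i\<in>T. c i *\<^sub>R e i)"
proof -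
  have fin: "finite T" and inj: "inj_on e T"
    using assms by (auto simp: is_basis_def intro: finite_subset inj_on_subset)
  obtain u where "x = (\<Sum>v\<in>e ` T. u v *\<^sub>R v)"
    using assms(4) fin by (auto simp: span_finite)
  then have "x = (\<Sum>i\<in>T. u (e i) *\<^sub>R e i)"
    using inj by (simp add: sum.reindex)
  then show ?thesis by (rule that)
qed

lemma basis_coeffs_zero:
  assumes "is_basis V S e" "finite S" "T \<subseteq> S" "(\<Sum>i\<in>T. c i *\<^sub>R e i) = 0" "i \<in> T"
  shows "c i = 0"
proof -
  have fin: "finite T" and inj: "inj_on e T"
    using assms by (auto simp: is_basis_def intro: finite_subset inj_on_subset)
  have "independent (e ` T)"
    using assms(1,3) independent_mono[OF _ image_mono] by (auto simp: is_basis_def)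
  moreover have "(\<Sum>v\<in>e ` T. c (the_inv_into T e v) *\<^sub>R v) = 0"
    using assms(4) inj by (simp add: sum.reindex the_inv_into_f_f)
  ultimately have "\<forall>v\<in>e ` T. c (the_inv_into T e v) = 0"
    by (metis dependent_finite finite_imageI[OF fin])
  then have "c (the_inv_into T e (e i)) = 0"
    using assms(5) by blast
  then show ?thesis using inj assms(5) by (simp add: the_inv_into_f_f)
qed

lemma torus_block_dim:
  assumes card: "CARD('m::{finite,linorder}) = 2*n+1" and k: "k \<le> n"
  shows "dim (joyce_b n \<inter> su_block (2*k+1) :: 'm cmat set) \<le> k"
proof -
  obtain l :: 'm where l: "blk l = n+1" using blk_last_exists[OF card] .
  have l_iff: "blk p = n+1 \<longleftrightarrow> p = l" for p :: 'm
    using l blk_last_unique[OF card] by blast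
  let ?c = "\<lambda>j. card {r :: 'm. blk r = j}"
  define D :: "nat \<Rightarrow> 'm cmat" where "D j = (\<chi> p q. if p = q then
    (if blk p = j then \<i> else if p = l then - of_nat (?c j) * \<i> else 0) else 0)" for j
  have "X \<in> span (D ` {n-k+1..n})" if Xb: "X \<in> joyce_b n" and Xh: "X \<in> su_block (2*k+1)" for X
  proof -
    have Xsu: "X \<in> su" using Xh by (simp add: su_block_def)
    define x where "x j = Im (block_avg j X)" for j
    have diag: "X $ p $ p = of_real (x (blk p)) * \<i>" for p
    proof -
      have "X $ p $ p = proj_b X $ p $ p" using proj_b_b[OF card Xb] by simp
      then have avg: "X $ p $ p = block_avg (blk p) X" by (simp add: proj_b_def)
      have "cnj (X $ p $ p) = - X $ p $ p"
        using Xsu by (simp add: su_def vec_eq_iff)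
      then have "Re (X $ p $ p) = 0" by (simp add: complex_eq_iff)
      then show ?thesis using avg by (simp add: x_def complex_eq_iff)
    qed
    have off: "X $ p $ q = 0" if "p \<noteq> q" for p q
      using joyce_b_iff[OF card, THEN iffD1, OF Xb] that by blast
    have low: "x j = 0" if "j \<le> n-k" for j
      using that by (simp add: x_def block_avg_def su_block_support[OF card k Xh])
    have X: "X = (\<Sum>j\<in>{n-k+1..n}. x j *\<^sub>R D j)"
    proof -
      have "X $ p $ q = (\<Sum>j\<in>{n-k+1..n}. x j *\<^sub>R D j $ p $ q)" for p q
      proof (cases "p = q")
        case False
        then show ?thesis by (simp add: off D_def)
      next
        case pq: True
        show ?thesis
        proof (cases "p = l")
          case False
          then have p: "blk p \<le> n" using l_iff[of p] blk_le[OF card, of p] by linarith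
          have "(\<Sum>j\<in>{n-k+1..n}. x j *\<^sub>R D j $ p $ q)
              = (\<Sum>j\<in>{n-k+1..n}. if j = blk p then of_real (x (blk p)) * \<i> else 0)"
            using pq False by (intro sum.cong[OF refl]) (auto simp: D_def scaleR_conv_of_real)
          also have "\<dots> = of_real (x (blk p)) * \<i>"
            using p low[of "blk p"] by auto
          finally show ?thesis using pq diag by simp
        next
          case True
          have "0 = trace X" using Xsu by (simp add: su_def)
          also have "\<dots> = X $ l $ l + (\<Sum>r\<in>UNIV-{l}. X $ r $ r)"
            unfolding trace_def by (rule sum.remove) auto
          also have "(\<Sum>r\<in>UNIV-{l}. X $ r $ r) = (\<Sum>r\<in>UNIV-{l}. of_real (x (blk r)) * \<i>)"
            using diag by simp
          also have "\<dots> = (\<Sum>j\<in>{1..n}. \<Sum>r | r \<in> UNIV-{l} \<and> blk r = j. of_real (x (blk r)) * \<i>)"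
          proof (rule sum.group[symmetric])
            show "blk ` (UNIV - {l}) \<subseteq> {1..n}"
            proof
              fix j assume "j \<in> blk ` (UNIV - {l})"
              then obtain r where "r \<noteq> l" "j = blk r" by blast
              then show "j \<in> {1..n}"
                using l_iff[of r] blk_le[OF card, of r] blk_pos[of r] by auto
            qed
          qed auto
          also have "\<dots> = (\<Sum>j\<in>{1..n}. of_nat (?c j) * (of_real (x j) * \<i>))"
          proof (rule sum.cong[OF refl])
            fix j assume "j \<in> {1..n}"
            then have "{r. r \<in> UNIV-{l} \<and> blk r = j} = {r. blk r = j}" using l by auto
            then have "(\<Sum>r | r \<in> UNIV-{l} \<and> blk r = j. of_real (x (blk r)) * \<i>)
                = (\<Sum>r :: 'm | blk r = j. of_real (x j) * \<i>)"
              by (intro sum.cong) auto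
            then show "(\<Sum>r | r \<in> UNIV-{l} \<and> blk r = j. of_real (x (blk r)) * \<i>)
                = of_nat (?c j) * (of_real (x j) * \<i>)" by simp
          qed
          also have "\<dots> = (\<Sum>j\<in>{n-k+1..n}. of_nat (?c j) * (of_real (x j) * \<i>))"
            using low by (intro sum.mono_neutral_right) auto
          finally have "X $ l $ l = - (\<Sum>j\<in>{n-k+1..n}. of_nat (?c j) * (of_real (x j) * \<i>))"
            by (simp add: add_eq_0_iff2)
          moreover have "(\<Sum>j\<in>{n-k+1..n}. x j *\<^sub>R D j $ l $ l) =
              (\<Sum>j\<in>{n-k+1..n}. - (of_nat (?c j) * (of_real (x j) * \<i>)))"
            using l by (intro sum.cong[OF refl]) (auto simp: D_def scaleR_conv_of_real)
          ultimately show ?thesis using pq True by (simp add: sum_negf)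
        qed
      qed
      then show ?thesis by (simp add: vec_eq_iff)
    qed
    show ?thesis
      by (subst X) (intro span_sum span_scale span_base imageI)
  qed
  then have "dim (joyce_b n \<inter> su_block (2*k+1) :: 'm cmat set) \<le> card (D ` {n-k+1..n})"
    by (intro dim_le_card) auto
  also have "\<dots> \<le> card {n-k+1..n}" by (rule card_image_le) simp
  finally show ?thesis using k by simp
qed

lemma torus_block_span:
  fixes e1 :: "nat \<Rightarrow> 'm::{finite,linorder} cmat"
  assumes card: "CARD('m) = 2*n+1" and k: "k \<le> n"
    and basis: "is_basis (joyce_b n) {1..n} e1"
    and e1: "\<And>i. i \<in> {n-k+1..n} \<Longrightarrow> e1 i \<in> su_block (2*k+1)"
    and X: "X \<in> joyce_b n" "X \<in> su_block (2*k+1)"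
  shows "X \<in> span (e1 ` {n-k+1..n})"
proof -
  let ?V = "joyce_b n \<inter> su_block (2*k+1) :: 'm cmat set"
  have sub: "{n-k+1..n} \<subseteq> {1..n}" by auto
  have inj: "inj_on e1 {n-k+1..n}"
    using basis sub unfolding is_basis_def by (metis inj_on_subset)
  have ind: "independent (e1 ` {n-k+1..n})"
    using basis unfolding is_basis_def by (intro independent_mono[OF _ image_mono[OF sub]]) blast
  have "e1 i \<in> joyce_b n" if "i \<in> {1..n}" for i
    using basis_mem[OF basis] that by simp
  then have "e1 ` {n-k+1..n} \<subseteq> ?V" using e1 sub by auto
  moreover have "dim ?V \<le> card (e1 ` {n-k+1..n})"
    using torus_block_dim[OF card k] inj k by (simp add: card_image)
  ultimately have "?V \<subseteq> span (e1 ` {n-k+1..n})"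
    using ind by (intro card_ge_dim_independent) auto
  then show ?thesis using X by blast
qed

lemma block_decomp:
  fixes e1 :: "nat \<Rightarrow> 'm::{finite,linorder} cmat"
  assumes card: "CARD('m) = 2*n+1" and k: "k \<le> n"
    and basis: "is_basis (joyce_b n) {1..n} e1"
    and e1: "\<And>i. i \<in> {n-k+1..n} \<Longrightarrow> e1 i \<in> su_block (2*k+1)"
    and X: "X \<in> su_block (2*k+1)"
  obtains c where "X = (\<Sum>i\<in>{n-k+1..n}. c i *\<^sub>R e1 i + proj_d i X + proj_f i X)"
proof -
  have Xsu: "X \<in> su" using X by (simp add: su_block_def)
  have "proj_b X \<in> span (e1 ` {n-k+1..n})"
    using torus_block_span[OF card k basis e1] proj_b_in[OF card Xsu] proj_b_block[OF card k X] by simp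
  then obtain c where c: "proj_b X = (\<Sum>i\<in>{n-k+1..n}. c i *\<^sub>R e1 i)"
    by (rule basis_span_coeffs[OF basis, rotated 2]) auto
  have "(\<Sum>i=1..n. proj_d i X + proj_f i X) = (\<Sum>i\<in>{n-k+1..n}. proj_d i X + proj_f i X)"
    using proj_d_block[OF card k X] proj_f_block[OF card k X]
    by (intro sum.mono_neutral_right) auto
  then have "X = (\<Sum>i\<in>{n-k+1..n}. c i *\<^sub>R e1 i) + (\<Sum>i\<in>{n-k+1..n}. proj_d i X + proj_f i X)"
    using proj_sum[OF card, of X] c by simp
  then show ?thesis by (intro that[of c]) (simp add: sum.distrib add.assoc)
qed

lemma sum_times_three:
  fixes w :: "nat \<times> nat \<Rightarrow> 'a::comm_monoid_add"
  shows "(\<Sum>s\<in>S \<times> {..<3}. w s) = (\<Sum>i\<in>S. w (i, 0) + w (i, 1) + w (i, 2))"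
  unfolding sum.cartesian_product' by (simp add: eval_nat_numeral)

lemma block_direct_sum:
  fixes e1 :: "nat \<Rightarrow> 'm::{finite,linorder} cmat"
  assumes card: "CARD('m) = 2*n+1" and k: "k \<le> n"
    and basis: "is_basis (joyce_b n) {1..n} e1"
    and e1: "\<And>i. i \<in> {n-k+1..n} \<Longrightarrow> e1 i \<in> su_block (2*k+1)"
  shows "is_direct_sum (su_block (2*k+1)) ({n-k+1..n} \<times> {..<3})
    (\<lambda>(i, s). [span {e1 i}, joyce_d i, joyce_f i] ! s)"
proof -
  let ?T = "{n-k+1..n}"
  let ?W = "\<lambda>(i, s). [span {e1 i}, joyce_d i, joyce_f i] ! s"
  have less3: "s < 3 \<longleftrightarrow> s = 0 \<or> s = 1 \<or> s = 2" for s :: nat by auto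
  have W: "(\<forall>s\<in>?T \<times> {..<3}. w s \<in> ?W s) \<longleftrightarrow>
    (\<forall>i\<in>?T. w (i,0) \<in> span {e1 i} \<and> w (i,1) \<in> joyce_d i \<and> w (i,2) \<in> joyce_f i)" for w
  proof -
    have "{..<3} = {0, 1, 2 :: nat}" by auto
    then show ?thesis by (simp add: split_paired_Ball_Sigma ball_conj_distrib)
  qed
  have Tpos: "i \<in> ?T \<Longrightarrow> 1 \<le> i" for i by simp
  have e1b: "e1 i \<in> joyce_b n" if "i \<in> ?T" for i
    using basis_mem[OF basis] that by simp
  show ?thesis
    unfolding is_direct_sum_def
  proof (intro conjI)
    show "finite (?T \<times> {..<3::nat})" by simp
    show "\<forall>s\<in>?T \<times> {..<3}. subspace (?W s)"
      by (auto simp: less3 subspace_joyce_d subspace_joyce_f)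
    show "su_block (2*k+1) = {\<Sum>s\<in>?T \<times> {..<3}. w s | w. \<forall>s\<in>?T \<times> {..<3}. w s \<in> ?W s}"
    proof (intro equalityI subsetI)
      fix X :: "'m cmat" assume X: "X \<in> su_block (2*k+1)"
      then have Xsu: "X \<in> su" by (simp add: su_block_def)
      obtain c where c: "X = (\<Sum>i\<in>?T. c i *\<^sub>R e1 i + proj_d i X + proj_f i X)"
        by (rule block_decomp[OF card k basis e1 X])
      let ?w = "\<lambda>(i, s). [c i *\<^sub>R e1 i, proj_d i X, proj_f i X] ! s"
      have "\<forall>s\<in>?T \<times> {..<3}. ?w s \<in> ?W s"
        unfolding W using Xsu by (auto intro: span_scale span_base proj_d_in proj_f_in)
      moreover have "X = (\<Sum>s\<in>?T \<times> {..<3}. ?w s)"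
        unfolding sum_times_three using c by simp
      ultimately show "X \<in> {\<Sum>s\<in>?T \<times> {..<3}. w s | w. \<forall>s\<in>?T \<times> {..<3}. w s \<in> ?W s}"
        by blast
    next
      fix X assume "X \<in> {\<Sum>s\<in>?T \<times> {..<3}. w s | w. \<forall>s\<in>?T \<times> {..<3}. w s \<in> ?W s}"
      then obtain w where X: "X = (\<Sum>s\<in>?T \<times> {..<3}. w s)" and w: "\<forall>s\<in>?T \<times> {..<3}. w s \<in> ?W s"
        by blast
      have "w (i,0) + w (i,1) + w (i,2) \<in> su_block (2*k+1)" if i: "i \<in> ?T" for i
      proof (intro subspace_add[OF subspace_su_block])
        have "span {e1 i} \<subseteq> su_block (2*k+1)"
          using e1[OF i] by (intro span_minimal subspace_su_block) auto
        then show "w (i,0) \<in> su_block (2*k+1)" using w[unfolded W] i by blast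
        show "w (i,1) \<in> su_block (2*k+1)"
          using w[unfolded W] i by (intro joyce_d_block[OF card k, of i]) auto
        show "w (i,2) \<in> su_block (2*k+1)"
          using w[unfolded W] i by (intro joyce_f_block[OF card k, of i]) auto
      qed
      then show "X \<in> su_block (2*k+1)"
        unfolding X sum_times_three by (intro subspace_sum[OF subspace_su_block])
    qed
    show "\<forall>w. (\<forall>s\<in>?T \<times> {..<3}. w s \<in> ?W s) \<and> (\<Sum>s\<in>?T \<times> {..<3}. w s) = 0 \<longrightarrow>
      (\<forall>s\<in>?T \<times> {..<3}. w s = 0)"
    proof (intro allI impI)
      fix w :: "nat \<times> nat \<Rightarrow> 'm cmat"
      assume A: "(\<forall>s\<in>?T \<times> {..<3}. w s \<in> ?W s) \<and> (\<Sum>s\<in>?T \<times> {..<3}. w s) = 0"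
      then have w: "\<And>i. i \<in> ?T \<Longrightarrow> w (i,0) \<in> span {e1 i}" "\<And>i. i \<in> ?T \<Longrightarrow> w (i,1) \<in> joyce_d i"
        "\<And>i. i \<in> ?T \<Longrightarrow> w (i,2) \<in> joyce_f i"
        and sum0: "(\<Sum>i\<in>?T. w (i, 0) + w (i, 1) + w (i, 2)) = 0"
        unfolding W sum_times_three by auto
      have w0b: "w (i,0) \<in> joyce_b n" if "i \<in> ?T" for i
      proof -
        have "span {e1 i} \<subseteq> joyce_b n"
          using e1b[OF that] by (intro span_minimal subspace_joyce_b[OF card]) auto
        then show ?thesis using w(1)[OF that] by blast
      qed
      have "proj_b 0 = (0 :: 'm cmat)" "proj_d i 0 = (0 :: 'm cmat)" "proj_f i 0 = (0 :: 'm cmat)" for i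
        using linear_0[OF linear_proj_b] linear_0[OF linear_proj_d] linear_0[OF linear_proj_f] by auto
      then have z: "(\<Sum>i\<in>?T. P (w (i, 0)) + P (w (i, 1)) + P (w (i, 2))) = 0"
        if "P \<in> {proj_b} \<union> range proj_d \<union> range proj_f" for P :: "'m cmat \<Rightarrow> 'm cmat"
      proof -
        have P: "linear P" using that linear_proj_b linear_proj_d linear_proj_f by auto
        have "P (\<Sum>i\<in>?T. w (i, 0) + w (i, 1) + w (i, 2)) = 0"
          unfolding sum0 by (rule linear_0[OF P])
        then show ?thesis by (simp add: linear_sum[OF P] linear_add[OF P])
      qed
      have w1: "w (j,1) = 0" if j: "j \<in> ?T" for j
      proof -
        have "(\<Sum>i\<in>?T. proj_d j (w (i, 0)) + proj_d j (w (i, 1)) + proj_d j (w (i, 2))) = 0"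
          by (rule z) auto
        also have "(\<Sum>i\<in>?T. proj_d j (w (i, 0)) + proj_d j (w (i, 1)) + proj_d j (w (i, 2)))
            = (\<Sum>i\<in>?T. if i = j then w (j, 1) else 0)"
          using w w0b by (intro sum.cong[OF refl])
            (auto simp: proj_d_b[OF card] proj_d_d[OF Tpos] proj_d_f[OF Tpos])
        finally show ?thesis using j by simp
      qed
      have w2: "w (j,2) = 0" if j: "j \<in> ?T" for j
      proof -
        have "(\<Sum>i\<in>?T. proj_f j (w (i, 0)) + proj_f j (w (i, 1)) + proj_f j (w (i, 2))) = 0"
          by (rule z) auto
        also have "(\<Sum>i\<in>?T. proj_f j (w (i, 0)) + proj_f j (w (i, 1)) + proj_f j (w (i, 2)))
            = (\<Sum>i\<in>?T. if i = j then w (j, 2) else 0)"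
          using w w0b by (intro sum.cong[OF refl])
            (auto simp: proj_f_b[OF card] proj_f_d[OF Tpos] proj_f_f[OF Tpos])
        finally show ?thesis using j by simp
      qed
      have "\<exists>c. w (i,0) = c *\<^sub>R e1 i" if "i \<in> ?T" for i
        using w(1)[OF that] unfolding span_singleton by (rule rangeE) (rule exI)
      then obtain c where c: "\<And>i. i \<in> ?T \<Longrightarrow> w (i,0) = c i *\<^sub>R e1 i" by metis
      have "(\<Sum>i\<in>?T. c i *\<^sub>R e1 i) = 0"
        using sum0 w1 w2 c by simp
      then have "c i = 0" if "i \<in> ?T" for i
        using basis_coeffs_zero[OF basis _ _ _ that, of c] by simp
      then show "\<forall>s\<in>?T \<times> {..<3}. w s = 0"
        using w1 w2 c by (auto simp: less3)
    qed
  qed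
qed


lemma block_induct:
  fixes e1 :: "nat \<Rightarrow> 'm::{finite,linorder} cmat"
  assumes card: "CARD('m) = 2*n+1" and k: "k \<le> n"
    and basis: "is_basis (joyce_b n) {1..n} e1"
    and e1: "\<And>i. i \<in> {n-k+1..n} \<Longrightarrow> e1 i \<in> su_block (2*k+1)"
    and V: "subspace V"
    and step: "\<And>i. i \<in> {n-k+1..n} \<Longrightarrow> e1 i \<in> V \<and> joyce_d i \<subseteq> V \<and> joyce_f i \<subseteq> V"
  shows "su_block (2*k+1) \<subseteq> V"
proof
  fix X :: "'m cmat" assume X: "X \<in> su_block (2*k+1)"
  then have Xsu: "X \<in> su" by (simp add: su_block_def)
  obtain c where c: "X = (\<Sum>i\<in>{n-k+1..n}. c i *\<^sub>R e1 i + proj_d i X + proj_f i X)"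
    by (rule block_decomp[OF card k basis e1 X])
  have "(\<Sum>i\<in>{n-k+1..n}. c i *\<^sub>R e1 i + proj_d i X + proj_f i X) \<in> V"
  proof (intro subspace_sum[OF V] subspace_add[OF V] subspace_scale[OF V])
    fix i assume i: "i \<in> {n-k+1..n}"
    then have "1 \<le> i" by simp
    with step[OF i] Xsu show "e1 i \<in> V" "proj_d i X \<in> V" "proj_f i X \<in> V"
      using proj_d_in proj_f_in by blast+
  qed
  then show "X \<in> V" using c by simp
qed

section \<open>The Obata connection\<close>

lemma linear_on_suD:
  assumes "linear_on_su T"
  shows "X \<in> su \<Longrightarrow> T X \<in> su"
    and "X \<in> su \<Longrightarrow> Y \<in> su \<Longrightarrow> T (X + Y) = T X + T Y"
    and "X \<in> su \<Longrightarrow> T (c *\<^sub>R X) = c *\<^sub>R T X"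
    and "X \<in> su \<Longrightarrow> T (- X) = - T X"
    and "X \<in> su \<Longrightarrow> Y \<in> su \<Longrightarrow> T (X - Y) = T X - T Y"
    and "T 0 = 0"
proof -
  show in_su: "X \<in> su \<Longrightarrow> T X \<in> su"
    and add: "X \<in> su \<Longrightarrow> Y \<in> su \<Longrightarrow> T (X + Y) = T X + T Y"
    and scale: "X \<in> su \<Longrightarrow> T (c *\<^sub>R X) = c *\<^sub>R T X" for X Y c
    using assms by (auto simp: linear_on_su_def)
  show neg: "X \<in> su \<Longrightarrow> T (- X) = - T X" for X
    using scale[of X "-1"] by simp
  show "T (X - Y) = T X - T Y" if X: "X \<in> su" and Y: "Y \<in> su"
    using add[OF X subspace_neg[OF subspace_su Y]] neg[OF Y] by simp
  show "T 0 = 0"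
    using scale[of 0 0] subspace_0[OF subspace_su] by simp
qed

lemma subspace_preimage_su:
  assumes T: "linear_on_su T" and V: "subspace V"
  shows "subspace {X \<in> su. T X \<in> V}"
  by (rule subspaceI) (auto simp: linear_on_suD[OF T] subspace_add subspace_scale subspace_0 subspace_su V)

definition obata where
  "obata I J K X Y = (1/2) *\<^sub>R (bracket X Y + I (bracket (I X) Y) - J (bracket X (J Y))
     + K (bracket (I X) (J Y)))"

context
  fixes I J K :: "'m::finite cmat \<Rightarrow> 'm cmat"
  assumes hc: "hypercomplex_structure I J K"
begin

lemma hc_linear: "linear_on_su I" "linear_on_su J" "linear_on_su K"
  using hc by (auto simp: hypercomplex_structure_def complex_structure_def)

lemmas hc_in_su = hc_linear[THEN linear_on_suD(1)]

lemma hc_mult: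
  assumes "X \<in> su"
  shows "I (I X) = - X" "J (J X) = - X" "K (K X) = - X"
    "I (J X) = K X" "J (I X) = - K X" "J (K X) = I X" "K (J X) = - I X" "K (I X) = J X" "I (K X) = - J X"
proof -
  have sq: "I (I Z) = - Z" "J (J Z) = - Z" "K (K Z) = - Z" and ij: "I (J Z) = K Z" "J (I Z) = - K Z"
    if "Z \<in> su" for Z
    using hc that by (auto simp: hypercomplex_structure_def complex_structure_def)
  show "I (I X) = - X" "J (J X) = - X" "K (K X) = - X" "I (J X) = K X" "J (I X) = - K X"
    using sq ij assms by auto
  show "I (K X) = - J X"
    using sq(1)[OF hc_in_su(2)[OF assms]] ij(1)[OF assms] by simp
  show "K (J X) = - I X"
    using ij(1)[OF hc_in_su(2)[OF assms]] sq(2)[OF assms] linear_on_suD(4)[OF hc_linear(1) assms] by simp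
  show "J (K X) = I X"
  proof -
    have "J (K X) = - J (J (I X))"
      using ij(2)[OF assms] linear_on_suD(4)[OF hc_linear(2) hc_in_su(3)[OF assms]] by simp
    then show ?thesis using sq(2)[OF hc_in_su(1)[OF assms]] by simp
  qed
  show "K (I X) = J X"
  proof -
    have "K (I X) = - J (I (I X))"
      using ij(2)[OF hc_in_su(1)[OF assms]] by simp
    then show ?thesis using sq(1)[OF assms] linear_on_suD(4)[OF hc_linear(2) assms] by simp
  qed
qed

lemma obata_formula:
  assumes "obata_connection I J K \<Gamma>" and x: "x \<in> SU" and X: "X \<in> su" and Y: "Y \<in> su"
  shows "\<Gamma> x X Y = obata I J K X Y"
proof -
  have su: "\<Gamma> x A B \<in> su" if "A \<in> su" "B \<in> su" for A B
    using assms(1) x that linear_on_suD(1)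
    by (auto simp: obata_connection_def affine_connection_def)
  have tors: "bracket A B = \<Gamma> x A B - \<Gamma> x B A" if "A \<in> su" "B \<in> su" for A B
    using assms(1) x that by (auto simp: obata_connection_def torsion_free_def)
  have pres: "\<Gamma> x A (I B) = I (\<Gamma> x A B)" "\<Gamma> x A (J B) = J (\<Gamma> x A B)" if "A \<in> su" "B \<in> su" for A B
    using assms(1) x that by (auto simp: obata_connection_def preserves_def)
  define a b c d where "a = \<Gamma> x X Y" and "b = \<Gamma> x Y X" and "c = \<Gamma> x (I X) Y" and "d = \<Gamma> x (J Y) X"
  note IX = hc_in_su(1)[OF X] and JY = hc_in_su(2)[OF Y]
  have abcd: "a \<in> su" "b \<in> su" "c \<in> su" "d \<in> su"
    using su X Y IX JY by (auto simp: a_def b_def c_def d_def)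
  note abcd' = abcd[THEN hc_in_su(1)] abcd[THEN hc_in_su(2)]
  have br: "bracket X Y = a - b" "bracket (I X) Y = c - I b" "bracket X (J Y) = J a - d"
      "bracket (I X) (J Y) = J c - I d"
    using X Y IX JY by (simp_all add: tors pres a_def b_def c_def d_def)
  have "I (c - I b) = I c + b" "J (J a - d) = - a - J d" "K (J c - I d) = - I c - J d"
    using abcd abcd' by (simp_all add: linear_on_suD(5) hc_linear hc_mult)
  then have "obata I J K X Y = (1/2) *\<^sub>R (a - b + (I c + b) - (- a - J d) + (- I c - J d))"
    unfolding obata_def br by simp
  then have "obata I J K X Y = (1/2) *\<^sub>R (a + a)"
    by simp
  then show ?thesis by (simp add: a_def scaleR_2[symmetric])
qed

end

lemma su_block_mono: "r \<le> s \<Longrightarrow> su_block r \<subseteq> su_block s"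
  unfolding su_block_def by auto (metis add_le_cancel_left order_less_le_trans)+

lemma su_block_bracket:
  assumes "X \<in> su_block r" "Y \<in> su_block r"
  shows "bracket X Y \<in> su_block r"
proof -
  have "bracket X Y $ p $ q \<noteq> 0 \<Longrightarrow> CARD('a) < pos p + r \<and> CARD('a) < pos q + r" for p q
  proof -
    assume "bracket X Y $ p $ q \<noteq> 0"
    then have "(X ** Y) $ p $ q \<noteq> 0 \<or> (Y ** X) $ p $ q \<noteq> 0" by (auto simp: bracket_def)
    then show ?thesis using assms unfolding su_block_def
      by (elim disjE matrix_mult_nonzero) blast+
  qed
  moreover have "bracket X Y \<in> su" using assms by (intro bracket_su) (auto simp: su_block_def)
  ultimately show ?thesis by (simp add: su_block_def)
qed

lemma diagonal_bracket_block:
  assumes "B \<in> su" "\<And>p q. p \<noteq> q \<Longrightarrow> B $ p $ q = 0" "Y \<in> su_block r"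
  shows "bracket B Y \<in> su_block r"
proof -
  have "bracket B Y $ p $ q \<noteq> 0 \<Longrightarrow> CARD('a) < pos p + r \<and> CARD('a) < pos q + r" for p q
  proof -
    assume "bracket B Y $ p $ q \<noteq> 0"
    then have "(B ** Y) $ p $ q \<noteq> 0 \<or> (Y ** B) $ p $ q \<noteq> 0" by (auto simp: bracket_def)
    then have "Y $ p $ q \<noteq> 0"
      using assms(2) by (elim disjE matrix_mult_nonzero) metis+
    then show ?thesis using assms(3) unfolding su_block_def by blast
  qed
  moreover have "bracket B Y \<in> su" using assms by (intro bracket_su) (auto simp: su_block_def)
  ultimately show ?thesis by (simp add: su_block_def)
qed

lemma joyce_d_bracket_block:
  fixes D Y :: "'m::{finite,linorder} cmat"
  assumes card: "CARD('m) = 2*n+1" and k: "k \<le> n" and i: "1 \<le> i" "i \<le> n-k"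
    and D: "D \<in> joyce_d i" and Y: "Y \<in> su_block (2*k+1)"
  shows "bracket D Y = 0"
proof -
  have "(D ** Y) $ p $ q = 0" "(Y ** D) $ p $ q = 0" for p q
    using i joyce_d_support[OF i(1) D] su_block_support[OF card k Y]
    by (metis matrix_mult_nonzero)+
  then show ?thesis by (simp add: bracket_def vec_eq_iff)
qed

lemma joyce_d_bracket_f:
  assumes i: "1 \<le> i" and D: "D \<in> joyce_d i" and F: "F \<in> joyce_f i"
  shows "bracket D F \<in> joyce_f i"
  unfolding joyce_f_iff[OF i]
proof (intro conjI allI impI)
  show "conj_transpose (bracket D F) = - bracket D F"
    using D F by (intro bracket_skew) (auto simp: joyce_d_def joyce_f_def su_def)
  fix p q assume "bracket D F $ p $ q \<noteq> 0"
  then have "(D ** F) $ p $ q \<noteq> 0 \<or> (F ** D) $ p $ q \<noteq> 0" by (auto simp: bracket_def)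
  then show "blk p = i \<and> i < blk q \<or> blk q = i \<and> i < blk p"
    using D F unfolding joyce_f_iff[OF i] joyce_d_iff[OF i]
    by (elim disjE matrix_mult_nonzero) (metis less_irrefl)+
qed

lemma joyce_f_bracket_block:
  fixes F Y :: "'m::{finite,linorder} cmat"
  assumes card: "CARD('m) = 2*n+1" and k: "k \<le> n" and i: "1 \<le> i" "i \<le> n-k"
    and F: "F \<in> joyce_f i" and Y: "Y \<in> su_block (2*k+1)"
  shows "bracket F Y \<in> joyce_f i"
  unfolding joyce_f_iff[OF i(1)]
proof (intro conjI allI impI)
  show "conj_transpose (bracket F Y) = - bracket F Y"
    using F Y by (intro bracket_skew) (auto simp: su_block_def joyce_f_def su_def)
  fix p q assume "bracket F Y $ p $ q \<noteq> 0"
  then have "(F ** Y) $ p $ q \<noteq> 0 \<or> (Y ** F) $ p $ q \<noteq> 0" by (auto simp: bracket_def)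
  then obtain r where "(F $ p $ r \<noteq> 0 \<and> Y $ r $ q \<noteq> 0) \<or> (Y $ p $ r \<noteq> 0 \<and> F $ r $ q \<noteq> 0)"
    by (metis matrix_mult_nonzero)
  moreover have "i < blk r \<and> i < blk s" if "Y $ r $ s \<noteq> 0" for r s
    using Y that i(2) unfolding su_block_iff[OF card k] by (meson le_less_trans)
  moreover have "blk r = i \<and> i < blk s \<or> blk s = i \<and> i < blk r" if "F $ r $ s \<noteq> 0" for r s
    using F that unfolding joyce_f_iff[OF i(1)] by blast
  ultimately show "blk p = i \<and> i < blk q \<or> blk q = i \<and> i < blk p"
    by (metis less_irrefl)
qed

lemma su_block_0: "0 \<in> su_block r"
  by (rule subspace_0[OF subspace_su_block])

locale joyce =
  fixes n k :: nat
    and e1 e2 e3 e4 :: "nat \<Rightarrow> 'm::{finite,linorder} cmat"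
    and I J K :: "'m cmat \<Rightarrow> 'm cmat"
  assumes card: "CARD('m) = 2*n+1" and k: "k \<le> n"
    and e1_block: "i \<in> {n-k+1..n} \<Longrightarrow> e1 i \<in> su_block (2*k+1)"
    and joyce: "joyce_hypercomplex n e1 e2 e3 e4 I J K"
begin

abbreviation h where "h \<equiv> su_block (2*k+1) :: 'm cmat set"

lemma hc: "hypercomplex_structure I J K" and bases: "joyce_bases n e1 e2 e3 e4"
  using joyce by (auto simp: joyce_hypercomplex_def)

lemma basis: "is_basis (joyce_b n) {1..n} e1"
  using bases by (simp add: joyce_bases_def)

lemmas lin = hc_linear[OF hc] and in_su = hc_in_su[OF hc] and mult = hc_mult[OF hc]

lemma h_su: "h \<subseteq> su"
  by (auto simp: su_block_def)

lemma d_span: "i \<in> {1..n} \<Longrightarrow> joyce_d i = span {e2 i, e3 i, e4 i}"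
  using bases by (simp add: joyce_bases_def)

lemma e_mem:
  assumes "i \<in> {1..n}"
  shows "e1 i \<in> joyce_b n" "e2 i \<in> joyce_d i" "e3 i \<in> joyce_d i" "e4 i \<in> joyce_d i"
  using basis_mem[OF basis assms] by (auto simp: d_span[OF assms] span_base)

lemma d_su: "joyce_d i \<subseteq> su"
  by (auto simp: joyce_d_def)

lemma e1_su: "i \<in> {1..n} \<Longrightarrow> e1 i \<in> su"
  using e_mem(1) by (auto simp: joyce_b_def)

lemma e_su:
  assumes "i \<in> {1..n}"
  shows "e1 i \<in> su" "e2 i \<in> su" "e3 i \<in> su" "e4 i \<in> su"
  using e1_su[OF assms] e_mem[OF assms] d_su by blast+

lemma action:
  assumes "i \<in> {1..n}"
  shows "I (e1 i) = e2 i" "I (e2 i) = - e1 i" "I (e3 i) = e4 i" "I (e4 i) = - e3 i"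
    "J (e1 i) = e3 i" "J (e2 i) = - e4 i" "J (e3 i) = - e1 i" "J (e4 i) = e2 i"
    "K (e1 i) = e4 i" "K (e2 i) = e3 i" "K (e3 i) = - e2 i" "K (e4 i) = - e1 i"
proof -
  show e: "I (e1 i) = e2 i" "I (e3 i) = e4 i" "J (e1 i) = e3 i" "J (e2 i) = - e4 i"
    "K (e1 i) = e4 i" "K (e2 i) = e3 i"
    using joyce assms by (auto simp: joyce_hypercomplex_def)
  note s = e_su[OF assms]
  show "I (e2 i) = - e1 i" "I (e4 i) = - e3 i" "J (e3 i) = - e1 i" "K (e3 i) = - e2 i" "K (e4 i) = - e1 i"
    using mult(1)[OF s(1)] mult(1)[OF s(3)] mult(2)[OF s(1)] mult(3)[OF s(2)] mult(3)[OF s(1)]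
    by (simp_all add: e)
  show "J (e4 i) = e2 i"
    using mult(2)[OF s(2)] linear_on_suD(4)[OF lin(2) s(4)] e by simp
qed

lemma f_action:
  assumes "i \<in> {1..n}" "F \<in> joyce_f i"
  shows "I F = bracket (e2 i) F" "J F = bracket (e3 i) F" "K F = bracket (e4 i) F"
  using joyce assms by (auto simp: joyce_hypercomplex_def)

lemma h_invariant:
  assumes "Y \<in> h"
  shows "I Y \<in> h" "J Y \<in> h" "K Y \<in> h"
proof -
  have "h \<subseteq> {X \<in> su. T X \<in> h}" if T: "T \<in> {I, J, K}" for T
  proof (rule block_induct[OF card k basis e1_block])
    have linT: "linear_on_su T" using T lin by auto
    show "subspace {X \<in> su. T X \<in> h}"
      by (rule subspace_preimage_su[OF linT subspace_su_block])
    then show "e1 i \<in> {X \<in> su. T X \<in> h} \<and> joyce_d i \<subseteq> {X \<in> su. T X \<in> h} \<and> joyce_f i \<subseteq> {X \<in> su. T X \<in> h}"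
      if i: "i \<in> {n-k+1..n}" for i
    proof (intro conjI)
      have i1: "i \<in> {1..n}" and i2: "n-k < i" using i by auto
      note dh = joyce_d_block[OF card k i2] and fh = joyce_f_block[OF card k i2]
      have eh: "e1 i \<in> h" "e2 i \<in> h" "e3 i \<in> h" "e4 i \<in> h"
        "- e1 i \<in> h" "- e2 i \<in> h" "- e3 i \<in> h" "- e4 i \<in> h"
        using e1_block[OF i] e_mem[OF i1] dh subspace_neg[OF subspace_su_block] by blast+
      show "e1 i \<in> {X \<in> su. T X \<in> h}"
        using T eh e_su[OF i1] by (auto simp: action[OF i1])
      have "T (e2 i) \<in> h" "T (e3 i) \<in> h" "T (e4 i) \<in> h"
        using T eh by (auto simp: action[OF i1])
      then show "joyce_d i \<subseteq> {X \<in> su. T X \<in> h}"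
        unfolding d_span[OF i1]
        using e_su[OF i1] by (intro span_minimal \<open>subspace {X \<in> su. T X \<in> h}\<close>) auto
      show "joyce_f i \<subseteq> {X \<in> su. T X \<in> h}"
      proof
        fix F :: "'m cmat" assume F: "F \<in> joyce_f i"
        have "T F \<in> joyce_f i"
          using T e_mem[OF i1] joyce_d_bracket_f[of i _ F] F i1 by (auto simp: f_action[OF i1 F])
        then show "F \<in> {X \<in> su. T X \<in> h}"
          using fh joyce_f_su[of i F] i1 F by auto
      qed
    qed
  qed
  then show "I Y \<in> h" "J Y \<in> h" "K Y \<in> h" using assms by blast+
qed

lemma obata_block:
  assumes X: "X \<in> su" and Y: "Y \<in> h"
    and 1: "\<And>Z. Z \<in> h \<Longrightarrow> bracket X Z \<in> h" and 2: "\<And>Z. Z \<in> h \<Longrightarrow> bracket (I X) Z \<in> h"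
  shows "obata I J K X Y \<in> h"
proof -
  note h = subspace_su_block[of "2*k+1"]
  show ?thesis
    unfolding obata_def
    using Y h_invariant 1 2
    by (intro subspace_scale[OF h] subspace_add[OF h] subspace_diff[OF h]) auto
qed

lemma subspace_normalizer: "subspace {X \<in> su. \<forall>Z\<in>h. bracket X Z \<in> h}"
  by (rule subspaceI) (auto simp: linear_add[OF linear_bracket_left] linear_scale[OF linear_bracket_left]
      linear_0[OF linear_bracket_left] subspace_add subspace_scale subspace_0 subspace_su subspace_su_block)

lemma d_normalizes:
  assumes "i \<in> {1..n}" "D \<in> joyce_d i" "Z \<in> h"
  shows "bracket D Z \<in> h"
proof (cases "i \<le> n-k")
  case True
  then have "bracket D Z = 0"
    using joyce_d_bracket_block[OF card k _ _ assms(2,3)] assms(1) by simp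
  then show ?thesis using su_block_0 by simp
next
  case False
  then have "D \<in> h" using joyce_d_block[OF card k _ assms(2)] by simp
  then show ?thesis using assms(3) by (rule su_block_bracket)
qed

lemma obata_f:
  assumes i: "i \<in> {1..n}" "i \<le> n-k" and F: "F \<in> joyce_f i" and Y: "Y \<in> h"
  shows "obata I J K F Y = 0"
proof -
  have i1: "1 \<le> i" using i by simp
  have comm: "bracket (I F) Z = I (bracket F Z)" if Z: "Z \<in> h" for Z
  proof -
    have "bracket (I F) Z = bracket (e2 i) (bracket F Z) - bracket F (bracket (e2 i) Z)"
      by (simp add: f_action[OF i(1) F] bracket_jacobi)
    also have "bracket (e2 i) Z = 0"
      using joyce_d_bracket_block[OF card k i1 i(2) _ Z] e_mem[OF i(1)] by blast
    also have "bracket (e2 i) (bracket F Z) = I (bracket F Z)"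
      using f_action[OF i(1) joyce_f_bracket_block[OF card k i1 i(2) F Z]] by simp
    finally show ?thesis by (simp add: linear_0[OF linear_bracket_right])
  qed
  have "bracket F Z \<in> su" if "Z \<in> h" for Z
    using bracket_su joyce_f_su[OF i1 F] h_su that by blast
  then show ?thesis
    using Y h_invariant(2)[OF Y] by (simp add: obata_def comm mult)
qed

lemma obata_invariant:
  assumes \<Gamma>: "obata_connection I J K \<Gamma>" and x: "x \<in> SU" and X: "X \<in> su" and Y: "Y \<in> h"
  shows "\<Gamma> x X Y \<in> h"
proof -
  have Ysu: "Y \<in> su" using Y h_su by blast
  let ?V = "{X \<in> su. \<Gamma> x X Y \<in> h}"
  have lin\<Gamma>: "linear_on_su (\<lambda>X. \<Gamma> x X Y)"
    using \<Gamma> x Ysu by (simp add: obata_connection_def affine_connection_def)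
  note formula = obata_formula[OF hc \<Gamma> x _ Ysu]
  have "su_block (2*n+1) \<subseteq> ?V"
  proof (rule block_induct[OF card order_refl basis])
    show "e1 i \<in> su_block (2*n+1)" if "i \<in> {n-n+1..n}" for i
      using that e1_su unfolding su_block_full[OF card] by simp
    show "subspace ?V" by (rule subspace_preimage_su[OF lin\<Gamma> subspace_su_block])
    fix i assume "i \<in> {n-n+1..n}"
    then have i: "i \<in> {1..n}" and i1: "1 \<le> i" by auto
    have b_norm: "bracket (e1 i) Z \<in> h" if "Z \<in> h" for Z
      using e_mem(1)[OF i] that e1_su[OF i] by (intro diagonal_bracket_block) (auto simp: joyce_b_def)
    note d_norm = d_normalizes[OF i]
    show "e1 i \<in> ?V \<and> joyce_d i \<subseteq> ?V \<and> joyce_f i \<subseteq> ?V"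
    proof (intro conjI subsetI CollectI)
      show "e1 i \<in> su" by (rule e1_su[OF i])
      then show "\<Gamma> x (e1 i) Y \<in> h"
        using obata_block[OF _ Y b_norm] d_norm e_mem[OF i] by (simp add: formula action[OF i])
    next
      fix D :: "'m cmat" assume D: "D \<in> joyce_d i"
      then show Dsu: "D \<in> su" using d_su by blast
      let ?N = "{X \<in> su. \<forall>Z\<in>h. bracket X Z \<in> h}"
      have N: "e1 i \<in> ?N" "e2 i \<in> ?N" "e3 i \<in> ?N" "e4 i \<in> ?N"
        using b_norm d_norm e_mem[OF i] e_su[OF i] by auto
      then have "I (e2 i) \<in> ?N" "I (e3 i) \<in> ?N" "I (e4 i) \<in> ?N"
        by (simp_all only: action[OF i] subspace_neg[OF subspace_normalizer])
      then have "joyce_d i \<subseteq> {X \<in> su. I X \<in> ?N}"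
        unfolding d_span[OF i] using e_su[OF i]
        by (intro span_minimal subspace_preimage_su lin subspace_normalizer) blast
      then show "\<Gamma> x D Y \<in> h"
        using D Dsu obata_block[OF Dsu Y] d_norm by (subst formula) auto
    next
      fix F :: "'m cmat" assume F: "F \<in> joyce_f i"
      then show Fsu: "F \<in> su" by (rule joyce_f_su[OF i1])
      show "\<Gamma> x F Y \<in> h"
      proof (cases "i \<le> n-k")
        case True
        then show ?thesis using obata_f[OF i True F Y] su_block_0 by (simp add: formula[OF Fsu])
      next
        case False
        then have "F \<in> h" using joyce_f_block[OF card k _ F] by simp
        then have "obata I J K F Y \<in> h"
          by (intro obata_block[OF Fsu Y] su_block_bracket h_invariant)
        then show ?thesis by (simp add: formula[OF Fsu])
      qed
    qed
  qed
  then show ?thesis using X su_block_full[OF card] by blast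
qed

end

section \<open>Linear maps and projections\<close>

lemma subspace_projection:
  fixes V :: "'v::real_vector set"
  assumes "subspace V"
  obtains Q :: "'v \<Rightarrow> 'v" where "linear Q" "\<And>x. Q x \<in> V" "\<And>x. x \<in> V \<Longrightarrow> Q x = x"
  using linear_exists_left_inverse_on[OF linear_id assms inj_on_id] by auto

lemma linear_on_su_extend:
  fixes T :: "'m::finite cmat \<Rightarrow> 'm cmat"
  assumes "linear_on_su T"
  obtains T' where "linear T'" "\<And>X. X \<in> su \<Longrightarrow> T' X = T X"
proof -
  obtain Q :: "'m cmat \<Rightarrow> 'm cmat" where Q: "linear Q" "\<And>x. Q x \<in> su" "\<And>x. x \<in> su \<Longrightarrow> Q x = x"
    using subspace_projection[OF subspace_su] by blast
  have "linear (\<lambda>X. T (Q X))"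
    by (rule linearI) (simp_all add: linear_add[OF Q(1)] linear_scale[OF Q(1)]
        linear_on_suD[OF assms] Q(2))
  then show ?thesis using that[of "\<lambda>X. T (Q X)"] Q(3) by simp
qed

lemma linear_on_su_bij:
  fixes P :: "'m::finite cmat \<Rightarrow> 'm cmat"
  assumes P: "linear_on_su P" and ker: "\<And>X. X \<in> su \<Longrightarrow> P X = 0 \<Longrightarrow> X = 0"
  shows "bij_betw P su su"
proof -
  obtain P' where P': "linear P'" "\<And>X. X \<in> su \<Longrightarrow> P' X = P X"
    using linear_on_su_extend[OF P] by blast
  have inj: "inj_on P su"
  proof (rule inj_onI)
    fix X Y assume XY: "X \<in> su" "Y \<in> su" "P X = P Y"
    then have "P (X - Y) = 0" by (simp add: linear_on_suD[OF P])
    then have "X - Y = 0" by (rule ker[OF subspace_diff[OF subspace_su XY(1,2)]])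
    then show "X = Y" by simp
  qed
  have img: "P' ` su = P ` su" using P'(2) by (rule image_cong[OF refl])
  have "inj_on P' su" using inj P'(2) by (simp add: inj_on_def)
  then have "inj_on P' (span su)" by (simp add: span_eq_iff[THEN iffD2, OF subspace_su])
  then have "dim (P' ` su) = dim (su :: 'm cmat set)"
    by (rule dim_image_eq[OF P'(1)])
  moreover have "subspace (P' ` su)"
    by (rule linear_subspace_image[OF P'(1) subspace_su])
  moreover have "P ` su \<subseteq> su" using linear_on_suD(1)[OF P] by blast
  ultimately have "P' ` su = su"
    unfolding img by (intro subspace_dim_equal subspace_su) simp_all
  then show ?thesis using inj img by (simp add: bij_betw_def)
qed

lemma bounded_bilinear_matrix_mult:
  "bounded_bilinear ((**) :: 'm::finite cmat \<Rightarrow> 'm cmat \<Rightarrow> 'm cmat)"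
  unfolding bilinear_conv_bounded_bilinear[symmetric] bilinear_def
  by (intro conjI allI linearI) (auto simp: vec_eq_iff matrix_matrix_mult_def algebra_simps
      sum.distrib scaleR_sum_right)

lemma conj_transpose_conj_transpose: "conj_transpose (conj_transpose X) = X"
  by (simp add: vec_eq_iff)

lemma bounded_linear_conj_transpose:
  "bounded_linear (conj_transpose :: 'm::finite cmat \<Rightarrow> 'm cmat)"
  using linear_conj_transpose by (simp add: linear_conv_bounded_linear)

section \<open>Curves in the special unitary group\<close>

lemma perm_prod_delta:
  fixes p :: "'m::finite \<Rightarrow> 'm"
  assumes "p permutes UNIV" "p \<noteq> id"
  shows "(\<Prod>j\<in>UNIV - {i}. (mat 1 :: 'm cmat) $ j $ p j) = 0"
proof -
  obtain j where j: "p j \<noteq> j" using assms(2) by (auto simp: fun_eq_iff)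
  then have "p (p j) \<noteq> p j" using permutes_inj[OF assms(1)] by (auto dest: injD)
  with j obtain l where "l \<noteq> i" "p l \<noteq> l" by metis
  then have "l \<in> UNIV - {i}" "(mat 1 :: 'm cmat) $ l $ p l = 0" by (auto simp: mat_def)
  then show ?thesis by (intro prod_zero) auto
qed

lemma det_has_vector_derivative:
  fixes g :: "real \<Rightarrow> 'm::finite cmat"
  assumes g: "(g has_vector_derivative V) (at t)" and one: "g t = mat 1"
  shows "((\<lambda>s. det (g s)) has_vector_derivative trace V) (at t)"
proof -
  have entry: "((\<lambda>s. g s $ i $ j) has_derivative (\<lambda>h. h *\<^sub>R V $ i $ j)) (at t)" for i j
    using bounded_linear.has_vector_derivative[OF bounded_linear_vec_nth
        bounded_linear.has_vector_derivative[OF bounded_linear_vec_nth g]]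
    by (simp add: has_vector_derivative_def)
  let ?d = "\<lambda>h. \<Sum>p | p permutes UNIV. of_int (sign p) *
    (\<Sum>i\<in>UNIV. (h *\<^sub>R V $ i $ p i) * (\<Prod>j\<in>UNIV - {i}. g t $ j $ p j))"
  have "((\<lambda>s. det (g s)) has_derivative ?d) (at t)"
    unfolding det_def
    by (intro has_derivative_sum has_derivative_mult_right has_derivative_prod entry)
  moreover have "?d h = h *\<^sub>R trace V" for h
  proof -
    have "?d h = (\<Sum>p\<in>{id}. of_int (sign p) *
        (\<Sum>i\<in>UNIV. (h *\<^sub>R V $ i $ p i) * (\<Prod>j\<in>UNIV - {i}. g t $ j $ p j)))"
      by (intro sum.mono_neutral_right) (auto simp: one perm_prod_delta permutes_id)
    also have "\<dots> = (\<Sum>i\<in>UNIV. h *\<^sub>R V $ i $ i)"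
      by (simp add: one mat_def sign_id)
    finally show ?thesis by (simp add: trace_def scaleR_sum_right)
  qed
  ultimately show ?thesis by (simp add: has_vector_derivative_def)
qed

lemma SU_conj_transpose_left: "x \<in> SU \<Longrightarrow> conj_transpose x ** x = mat 1"
  by (simp add: SU_def matrix_left_right_inverse)

lemma matrix_inv_SU:
  assumes "x \<in> SU"
  shows "matrix_inv x = conj_transpose x"
proof -
  have "invertible x" using assms SU_conj_transpose_left[OF assms] by (auto simp: invertible_def SU_def)
  then have "matrix_inv x ** x = mat 1" "x ** matrix_inv x = mat 1"
    unfolding invertible_def matrix_inv_def by (metis (mono_tags, lifting) someI_ex)+
  then have "matrix_inv x = (conj_transpose x ** x) ** matrix_inv x"
    by (simp add: SU_conj_transpose_left[OF assms])
  also have "\<dots> = conj_transpose x"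
    using \<open>x ** matrix_inv x = mat 1\<close> by (simp add: matrix_mul_assoc[symmetric])
  finally show ?thesis .
qed

lemma one_in_SU: "mat 1 \<in> SU"
proof -
  have "conj_transpose (mat 1) = (mat 1 :: 'a cmat)"
    by (auto simp: vec_eq_iff mat_def)
  then show ?thesis by (simp add: SU_def)
qed

lemma SU_velocity:
  fixes g :: "real \<Rightarrow> 'm::finite cmat"
  assumes SU: "g ` {0..1} \<subseteq> SU" and t: "t \<in> {0<..<1}" and diff: "g differentiable (at t)"
  shows "matrix_inv (g t) ** vector_derivative g (at t) \<in> su"
proof -
  let ?V = "vector_derivative g (at t)" and ?x = "g t"
  have g: "(g has_vector_derivative ?V) (at t)"
    using diff by (simp add: vector_derivative_works)
  have x: "?x \<in> SU" using SU t by auto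
  have gSU: "g s \<in> SU" if "s \<in> {0<..<1}" for s using SU that by auto
  have const: "f' = 0" if "(f has_vector_derivative f') (at t)" "\<And>s. s \<in> {0<..<1} \<Longrightarrow> f s = c"
    for f :: "real \<Rightarrow> 'b::real_normed_vector" and f' c
  proof -
    have "((\<lambda>s. c) has_vector_derivative f') (at t)"
      by (rule has_vector_derivative_transform_within_open[OF that(1) _ t]) (auto simp: that(2))
    then show ?thesis by (rule vector_derivative_unique_at) (rule has_vector_derivative_const)
  qed
  have "((\<lambda>s. conj_transpose (g s) ** g s) has_vector_derivative
      conj_transpose ?x ** ?V + conj_transpose ?V ** ?x) (at t)"
    by (intro bounded_bilinear.has_vector_derivative[OF bounded_bilinear_matrix_mult]
        bounded_linear.has_vector_derivative[OF bounded_linear_conj_transpose] g)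
  then have "conj_transpose ?x ** ?V + conj_transpose ?V ** ?x = 0"
    by (rule const) (rule SU_conj_transpose_left[OF gSU])
  then have skew: "conj_transpose (conj_transpose ?x ** ?V) = - (conj_transpose ?x ** ?V)"
    by (simp add: conj_transpose_mult eq_neg_iff_add_eq_0 add.commute conj_transpose_conj_transpose)
  have "det (conj_transpose ?x) * det ?x = 1"
    using SU_conj_transpose_left[OF x] by (metis det_mul det_I)
  then have det: "det (conj_transpose ?x) = 1" using x by (simp add: SU_def)
  have "((\<lambda>s. conj_transpose ?x ** g s) has_vector_derivative conj_transpose ?x ** ?V) (at t)"
    by (rule bounded_linear.has_vector_derivative[OF
        bounded_bilinear.bounded_linear_right[OF bounded_bilinear_matrix_mult] g])
  then have "((\<lambda>s. det (conj_transpose ?x ** g s)) has_vector_derivative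
      trace (conj_transpose ?x ** ?V)) (at t)"
    by (rule det_has_vector_derivative) (rule SU_conj_transpose_left[OF x])
  then have "trace (conj_transpose ?x ** ?V) = 0"
  proof (rule const)
    show "det (conj_transpose ?x ** g s) = 1" if "s \<in> {0<..<1}" for s
      using gSU[OF that] by (simp add: det_mul det SU_def)
  qed
  then show ?thesis using skew by (simp add: su_def matrix_inv_SU[OF x])
qed

lemma SU_norm_bound:
  fixes x :: "'m::finite cmat"
  assumes "x \<in> SU"
  shows "norm (conj_transpose x) \<le> CARD('m) * CARD('m)"
proof -
  have entry: "norm (x $ p $ q) \<le> 1" for p q
  proof -
    have "complex_of_real (\<Sum>q\<in>UNIV. (norm (x $ p $ q))\<^sup>2) = (x ** conj_transpose x) $ p $ p"
      unfolding of_real_sum complex_norm_square by (simp add: matrix_matrix_mult_def)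
    also have "\<dots> = 1" using assms by (simp add: SU_def mat_def)
    finally have "(\<Sum>q\<in>UNIV. (norm (x $ p $ q))\<^sup>2) = 1"
      by (metis of_real_eq_1_iff)
    moreover have "(norm (x $ p $ q))\<^sup>2 \<le> (\<Sum>q\<in>UNIV. (norm (x $ p $ q))\<^sup>2)"
      by (rule member_le_sum) auto
    ultimately have "(norm (x $ p $ q))\<^sup>2 \<le> 1" by simp
    then show ?thesis by (simp add: abs_square_le_1)
  qed
  have row: "norm (conj_transpose x $ p) \<le> CARD('m)" for p
  proof -
    have "norm (conj_transpose x $ p) \<le> (\<Sum>q\<in>UNIV. norm (conj_transpose x $ p $ q))"
      unfolding norm_vec_def by (rule L2_set_le_sum) simp
    also have "\<dots> \<le> (\<Sum>q\<in>(UNIV :: 'm set). 1)"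
      by (intro sum_mono) (simp add: entry)
    finally show ?thesis by simp
  qed
  have "norm (conj_transpose x) \<le> (\<Sum>p\<in>UNIV. norm (conj_transpose x $ p))"
    unfolding norm_vec_def[of "conj_transpose x"] by (rule L2_set_le_sum) simp
  also have "\<dots> \<le> (\<Sum>p\<in>(UNIV :: 'm set). real CARD('m))"
    by (intro sum_mono row)
  finally show ?thesis by simp
qed

lemma piecewise_C1_derivative_bound:
  fixes g :: "real \<Rightarrow> 'v::real_normed_vector"
  assumes "piecewise_C1 g"
  obtains S C where "finite S" "\<forall>t\<in>{0<..<1} - S. norm (vector_derivative g (at t)) \<le> C"
proof -
  obtain m :: nat and \<tau> where \<tau>: "\<tau> 0 = 0" "\<tau> m = 1"
    and D: "\<And>i. i < m \<Longrightarrow> \<exists>D. continuous_on {\<tau> i..\<tau> (Suc i)} D \<and>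
       (\<forall>t\<in>{\<tau> i..\<tau> (Suc i)}. (g has_vector_derivative D t) (at t within {\<tau> i..\<tau> (Suc i)}))"
    using assms unfolding piecewise_C1_def by metis
  have "\<exists>C. \<forall>t\<in>{\<tau> i<..<\<tau> (Suc i)}. norm (vector_derivative g (at t)) \<le> C" if "i < m" for i
  proof -
    obtain D where D: "continuous_on {\<tau> i..\<tau> (Suc i)} D"
      "\<And>t. t \<in> {\<tau> i..\<tau> (Suc i)} \<Longrightarrow> (g has_vector_derivative D t) (at t within {\<tau> i..\<tau> (Suc i)})"
      using D[OF \<open>i < m\<close>] by blast
    have "bounded (D ` {\<tau> i..\<tau> (Suc i)})"
      by (intro compact_imp_bounded compact_continuous_image D compact_Icc)
    then obtain C where C: "\<And>t. t \<in> {\<tau> i..\<tau> (Suc i)} \<Longrightarrow> norm (D t) \<le> C"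
      unfolding bounded_iff by blast
    have "vector_derivative g (at t) = D t" if "t \<in> {\<tau> i<..<\<tau> (Suc i)}" for t
    proof (rule vector_derivative_at)
      have "at t within {\<tau> i..\<tau> (Suc i)} = at t"
        using that by (intro at_within_interior) simp
      then show "(g has_vector_derivative D t) (at t)" using D(2)[of t] that by simp
    qed
    then show ?thesis using C by (intro exI[of _ C]) auto
  qed
  then obtain C where C: "\<And>i t. i < m \<Longrightarrow> t \<in> {\<tau> i<..<\<tau> (Suc i)} \<Longrightarrow> norm (vector_derivative g (at t)) \<le> C i"
    by metis
  show ?thesis
  proof (intro that ballI)
    show "finite (\<tau> ` {..m})" by simp
    fix t assume t: "t \<in> {0<..<1} - \<tau> ` {..m}"
    define i where "i = (LEAST i. t < \<tau> i)"
    have ex: "t < \<tau> m" using t \<tau> by simp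
    have i: "t < \<tau> i" "i \<le> m" unfolding i_def using ex by (auto intro: LeastI Least_le)
    have "i \<noteq> 0" using i t \<tau> by (intro notI) simp
    then obtain l where l: "i = Suc l" using not0_implies_Suc by blast
    have "\<not> t < \<tau> l" using not_less_Least[of l "\<lambda>i. t < \<tau> i"] l by (simp add: i_def)
    moreover have "t \<noteq> \<tau> l" using t l i(2) by auto
    ultimately have "norm (vector_derivative g (at t)) \<le> C l"
      using i l by (intro C) auto
    also have "C l \<le> (\<Sum>i<m. \<bar>C i\<bar>)"
      using member_le_sum[of l "{..<m}" "\<lambda>i. \<bar>C i\<bar>"] l i(2) by auto
    finally show "norm (vector_derivative g (at t)) \<le> (\<Sum>i<m. \<bar>C i\<bar>)" .
  qed
qed

lemma gronwall_zero:
  fixes W :: "real \<Rightarrow> 'v::euclidean_space"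
  assumes cont: "continuous_on {0..1} W" and fin: "finite S"
    and der: "\<And>t. t \<in> {0<..<1} - S \<Longrightarrow> (W has_vector_derivative W' t) (at t)"
    and bound: "\<And>t. t \<in> {0<..<1} - S \<Longrightarrow> norm (W' t) \<le> C * norm (W t)"
    and t0: "t0 \<in> {0, 1}" "W t0 = 0" and t: "t \<in> {0..1}"
  shows "W t = 0"
proof -
  define \<sigma> :: real where "\<sigma> = (if t0 = 0 then 1 else -1)"
  define \<phi> where "\<phi> s = exp (-2 * \<sigma> * C * s) * (W s \<bullet> W s)" for s
  define \<phi>' where "\<phi>' s = (if s \<in> {0<..<1} - S
    then exp (-2 * \<sigma> * C * s) * (2 * (W s \<bullet> W' s) - 2 * \<sigma> * C * (W s \<bullet> W s)) else 0)" for s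
  have \<sigma>: "\<sigma> * \<sigma> = 1" "\<bar>\<sigma>\<bar> = 1" by (auto simp: \<sigma>_def)
  have sign: "0 \<le> - \<sigma> * \<phi>' s" for s
  proof (cases "s \<in> {0<..<1} - S")
    case True
    have "\<sigma> * (W s \<bullet> W' s) \<le> \<bar>W s \<bullet> W' s\<bar>"
      using \<sigma>(2) abs_ge_self[of "\<sigma> * (W s \<bullet> W' s)"] by (simp add: abs_mult)
    also have "\<dots> \<le> norm (W s) * norm (W' s)" by (rule Cauchy_Schwarz_ineq2)
    also have "\<dots> \<le> norm (W s) * (C * norm (W s))"
      using bound[OF True] by (intro mult_left_mono) auto
    also have "\<dots> = C * (W s \<bullet> W s)" by (simp add: dot_square_norm power2_eq_square)
    finally have "0 \<le> C * (W s \<bullet> W s) - \<sigma> * (W s \<bullet> W' s)" by simp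
    then have "0 \<le> exp (-2 * \<sigma> * C * s) * (2 * (C * (W s \<bullet> W s) - \<sigma> * (W s \<bullet> W' s)))"
      by simp
    also have "\<dots> = exp (-2 * \<sigma> * C * s) * (2 * ((\<sigma> * \<sigma>) * C * (W s \<bullet> W s) - \<sigma> * (W s \<bullet> W' s)))"
      by (simp add: \<sigma>)
    also have "\<dots> = - \<sigma> * \<phi>' s"
      using True by (simp add: \<phi>'_def algebra_simps)
    finally show ?thesis .
  next
    case False
    then have "\<phi>' s = 0" unfolding \<phi>'_def by (rule if_not_P)
    then show ?thesis by simp
  qed
  have "((\<lambda>s. - \<sigma> * \<phi>' s) has_integral - \<sigma> * (\<phi> b - \<phi> a)) {a..b}" if ab: "0 \<le> a" "a \<le> b" "b \<le> 1" for a b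
  proof (intro has_integral_mult_right fundamental_theorem_of_calculus_interior_strong[OF fin ab(2)])
    fix s assume s: "s \<in> {a<..<b} - S"
    then have s': "s \<in> {0<..<1} - S" using ab by auto
    have "((\<lambda>s. W s \<bullet> W s) has_vector_derivative W s \<bullet> W' s + W' s \<bullet> W s) (at s)"
      by (intro bounded_bilinear.has_vector_derivative[OF bounded_bilinear_inner] der[OF s'])
    then have "((\<lambda>s. W s \<bullet> W s) has_real_derivative 2 * (W s \<bullet> W' s)) (at s)"
      by (simp add: has_real_derivative_iff_has_vector_derivative inner_commute)
    then have "(\<phi> has_real_derivative \<phi>' s) (at s)"
      unfolding \<phi>_def using s'
      by (auto intro!: derivative_eq_intros simp: \<phi>'_def algebra_simps)
    then show "(\<phi> has_vector_derivative \<phi>' s) (at s)"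
      by (simp add: has_real_derivative_iff_has_vector_derivative)
  next
    show "continuous_on {a..b} \<phi>"
      unfolding \<phi>_def using ab
      by (intro continuous_intros continuous_on_subset[OF cont]) auto
  qed
  then have mono: "0 \<le> - \<sigma> * (\<phi> b - \<phi> a)" if "0 \<le> a" "a \<le> b" "b \<le> 1" for a b
    using has_integral_nonneg sign that by blast
  have "\<phi> t0 = 0" using t0(2) by (simp add: \<phi>_def)
  then have "\<phi> t \<le> 0"
    using mono[of 0 t] mono[of t 1] t t0(1) by (auto simp: \<sigma>_def)
  then have "W t \<bullet> W t \<le> 0" by (simp add: \<phi>_def mult_le_0_iff)
  then show ?thesis by (metis inner_eq_zero_iff inner_ge_zero order_antisym)
qed

lemma obata_bounded:
  fixes I J K :: "'m::finite cmat \<Rightarrow> 'm cmat"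
  assumes hc: "hypercomplex_structure I J K" and \<Gamma>: "obata_connection I J K \<Gamma>"
  obtains C where "0 < C"
    "\<forall>x\<in>SU. \<forall>X\<in>su. \<forall>Y\<in>su. norm (\<Gamma> x X Y) \<le> C * norm X * norm Y"
proof -
  obtain I' where I': "linear I'" "\<And>X. X \<in> su \<Longrightarrow> I' X = I X"
    using linear_on_su_extend[OF hc_linear(1)[OF hc]] by blast
  obtain J' where J': "linear J'" "\<And>X. X \<in> su \<Longrightarrow> J' X = J X"
    using linear_on_su_extend[OF hc_linear(2)[OF hc]] by blast
  obtain K' where K': "linear K'" "\<And>X. X \<in> su \<Longrightarrow> K' X = K X"
    using linear_on_su_extend[OF hc_linear(3)[OF hc]] by blast
  note lins = I'(1) J'(1) K'(1)
  note addl = lins[THEN linear_add] lins[THEN linear_scale]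
    linear_add[OF linear_bracket_left] linear_add[OF linear_bracket_right]
    linear_scale[OF linear_bracket_left] linear_scale[OF linear_bracket_right]
  have "bilinear (obata I' J' K')"
    unfolding bilinear_def obata_def
    by (intro conjI allI linearI) (simp_all add: addl algebra_simps)
  then obtain C where C: "0 < C" "\<And>X Y. norm (obata I' J' K' X Y) \<le> C * norm X * norm Y"
    using bilinear_bounded_pos by blast
  have "norm (\<Gamma> x X Y) \<le> C * norm X * norm Y" if x: "x \<in> SU" and X: "X \<in> su" and Y: "Y \<in> su" for x X Y
  proof -
    have "\<Gamma> x X Y = obata I J K X Y" by (rule obata_formula[OF hc \<Gamma> x X Y])
    also have "\<dots> = obata I' J' K' X Y"
      using X Y hc_in_su[OF hc] by (simp add: obata_def I' J' K' bracket_su)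
    finally show ?thesis using C(2) by simp
  qed
  then show ?thesis by (intro that[OF C(1)] ballI)
qed

section \<open>Parallel transport\<close>

context
  fixes I J K :: "'m::finite cmat \<Rightarrow> 'm cmat" and \<Gamma> and g :: "real \<Rightarrow> 'm cmat"
  assumes hc: "hypercomplex_structure I J K" and \<Gamma>: "obata_connection I J K \<Gamma>"
    and g: "piecewise_C1 g" "g ` {0..1} \<subseteq> SU"
begin

lemma SU_path: "t \<in> {0<..<1} \<Longrightarrow> g t \<in> SU"
  using g(2) by auto

lemma connection_linear:
  assumes "x \<in> SU" "X \<in> su"
  shows "linear_on_su (\<Gamma> x X)"
  using \<Gamma> assms by (simp add: obata_connection_def affine_connection_def)

text \<open>The estimate on \<open>L\<close> says that the equation of parallel transport descends to the quotient by
  the kernel of \<open>L\<close>.\<close>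

lemma parallel_kernel:
  assumes Y: "parallel_along \<Gamma> g Y" and L: "linear L"
    and bound: "\<And>x A B. x \<in> SU \<Longrightarrow> A \<in> su \<Longrightarrow> B \<in> su \<Longrightarrow> norm (L (\<Gamma> x A B)) \<le> C * norm A * norm (L B)"
    and t0: "t0 \<in> {0, 1}" "L (Y t0) = 0" and t: "t \<in> {0..1}"
  shows "L (Y t) = (0 :: 'm cmat)"
proof -
  let ?V = "\<lambda>t. matrix_inv (g t) ** vector_derivative g (at t)"
  obtain S where S: "finite S" "\<And>t. t \<in> {0<..<1} - S \<Longrightarrow> g differentiable (at t)"
    "\<And>t. t \<in> {0<..<1} - S \<Longrightarrow> (Y has_vector_derivative - \<Gamma> (g t) (?V t) (Y t)) (at t)"
    using Y unfolding parallel_along_def by blast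
  obtain S' D where S': "finite S'" "\<forall>t\<in>{0<..<1} - S'. norm (vector_derivative g (at t)) \<le> D"
    by (rule piecewise_C1_derivative_bound[OF g(1)])
  obtain M where M: "0 < M" "\<forall>(A :: 'm cmat) (B :: 'm cmat). norm (A ** B) \<le> norm A * norm B * M"
    using bounded_bilinear.pos_bounded[OF bounded_bilinear_matrix_mult[where 'm='m]] by auto
  have blL: "bounded_linear L" using L by (simp add: linear_conv_bounded_linear)
  let ?N = "real (CARD('m) * CARD('m))"
  show ?thesis
  proof (rule gronwall_zero[where W = "\<lambda>t. L (Y t)" and S = "S \<union> S'"
        and W' = "\<lambda>t. L (- \<Gamma> (g t) (?V t) (Y t))" and C = "\<bar>C\<bar> * (?N * \<bar>D\<bar> * M)"])
    show "continuous_on {0..1} (\<lambda>t. L (Y t))"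
      using Y bounded_linear.continuous_on[OF blL] by (auto simp: parallel_along_def)
    show "finite (S \<union> S')" using S S' by simp
    show "t0 \<in> {0, 1}" "L (Y t0) = 0" "t \<in> {0..1}" by (fact t0 t)+
    fix s assume s: "s \<in> {0<..<1} - (S \<union> S')"
    show "((\<lambda>t. L (Y t)) has_vector_derivative L (- \<Gamma> (g s) (?V s) (Y s))) (at s)"
      using S(3) s by (intro bounded_linear.has_vector_derivative[OF blL]) auto
    have gs: "g s \<in> SU" using SU_path s by simp
    have V: "?V s \<in> su" using S(2) s by (intro SU_velocity g(2)) auto
    have Ys: "Y s \<in> su" using Y s by (auto simp: parallel_along_def)
    have "norm (?V s) \<le> norm (conj_transpose (g s)) * norm (vector_derivative g (at s)) * M"
      unfolding matrix_inv_SU[OF gs] using M(2) by blast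
    also have "\<dots> \<le> ?N * \<bar>D\<bar> * M"
      using SU_norm_bound[OF gs] S'(2)[rule_format, of s] s M(1) by (intro mult_right_mono mult_mono) auto
    finally have Vb: "norm (?V s) \<le> ?N * \<bar>D\<bar> * M" .
    have "norm (L (- \<Gamma> (g s) (?V s) (Y s))) = norm (L (\<Gamma> (g s) (?V s) (Y s)))"
      by (simp add: linear_neg[OF L])
    also have "\<dots> \<le> C * norm (?V s) * norm (L (Y s))" by (rule bound[OF gs V Ys])
    also have "\<dots> \<le> \<bar>C\<bar> * (?N * \<bar>D\<bar> * M) * norm (L (Y s))"
      using Vb by (intro mult_right_mono mult_mono) auto
    finally show "norm (L (- \<Gamma> (g s) (?V s) (Y s))) \<le> \<bar>C\<bar> * (?N * \<bar>D\<bar> * M) * norm (L (Y s))" .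
  qed
qed

lemma parallel_zero:
  assumes "parallel_along \<Gamma> g Y" "t0 \<in> {0, 1}" "Y t0 = 0" "t \<in> {0..1}"
  shows "Y t = 0"
proof -
  obtain C where C: "0 < C"
    "\<forall>x\<in>SU. \<forall>X\<in>su. \<forall>Y\<in>su. norm (\<Gamma> x X Y) \<le> C * norm X * norm Y"
    by (rule obata_bounded[OF hc \<Gamma>])
  show ?thesis
    by (rule parallel_kernel[OF assms(1) linear_ident C(2)[rule_format] assms(2,3,4)])
qed

lemma parallel_add:
  assumes "parallel_along \<Gamma> g Y" "parallel_along \<Gamma> g Z"
  shows "parallel_along \<Gamma> g (\<lambda>t. Y t + Z t)"
proof -
  let ?V = "\<lambda>t. matrix_inv (g t) ** vector_derivative g (at t)"
  obtain S where S: "finite S" "\<And>t. t \<in> {0<..<1} - S \<Longrightarrow> g differentiable (at t)"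
    "\<And>t. t \<in> {0<..<1} - S \<Longrightarrow> (Y has_vector_derivative - \<Gamma> (g t) (?V t) (Y t)) (at t)"
    using assms(1) unfolding parallel_along_def by blast
  obtain S' where S': "finite S'"
    "\<And>t. t \<in> {0<..<1} - S' \<Longrightarrow> (Z has_vector_derivative - \<Gamma> (g t) (?V t) (Z t)) (at t)"
    using assms(2) unfolding parallel_along_def by blast
  have su: "Y t \<in> su" "Z t \<in> su" if "t \<in> {0..1}" for t
    using assms that by (auto simp: parallel_along_def)
  have "((\<lambda>t. Y t + Z t) has_vector_derivative - \<Gamma> (g t) (?V t) (Y t + Z t)) (at t)"
    if t: "t \<in> {0<..<1} - (S \<union> S')" for t
  proof -
    have "?V t \<in> su" using S(2) t by (intro SU_velocity g(2)) auto
    then have "- \<Gamma> (g t) (?V t) (Y t + Z t) = - \<Gamma> (g t) (?V t) (Y t) + - \<Gamma> (g t) (?V t) (Z t)"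
      using linear_on_suD(2)[OF connection_linear[OF SU_path]] su t by auto
    then show ?thesis
      using has_vector_derivative_add[OF S(3) S'(2)] t by simp
  qed
  moreover have "continuous_on {0..1} (\<lambda>t. Y t + Z t)"
    using assms unfolding parallel_along_def by (intro continuous_on_add) blast+
  moreover have "\<forall>t\<in>{0..1}. Y t + Z t \<in> su"
    using su subspace_add[OF subspace_su] by blast
  moreover have "finite (S \<union> S')" "\<And>t. t \<in> {0<..<1} - (S \<union> S') \<Longrightarrow> g differentiable (at t)"
    using S(1,2) S'(1) by auto
  ultimately show ?thesis
    unfolding parallel_along_def by blast
qed

lemma parallel_map:
  assumes Y: "parallel_along \<Gamma> g Y" and T: "linear_on_su T"
    and comm: "\<And>x A B. x \<in> SU \<Longrightarrow> A \<in> su \<Longrightarrow> B \<in> su \<Longrightarrow> \<Gamma> x A (T B) = T (\<Gamma> x A B)"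
  obtains Z where "parallel_along \<Gamma> g Z" "\<And>t. t \<in> {0..1} \<Longrightarrow> Z t = T (Y t)"
proof -
  let ?V = "\<lambda>t. matrix_inv (g t) ** vector_derivative g (at t)"
  obtain S where S: "finite S" "\<And>t. t \<in> {0<..<1} - S \<Longrightarrow> g differentiable (at t)"
    "\<And>t. t \<in> {0<..<1} - S \<Longrightarrow> (Y has_vector_derivative - \<Gamma> (g t) (?V t) (Y t)) (at t)"
    using Y unfolding parallel_along_def by blast
  have su: "Y t \<in> su" if "t \<in> {0..1}" for t
    using Y that by (auto simp: parallel_along_def)
  obtain T' where T': "linear T'" "\<And>X. X \<in> su \<Longrightarrow> T' X = T X"
    using linear_on_su_extend[OF T] by blast
  have bl: "bounded_linear T'" using T' by (simp add: linear_conv_bounded_linear)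
  have "((\<lambda>t. T' (Y t)) has_vector_derivative - \<Gamma> (g t) (?V t) (T' (Y t))) (at t)"
    if t: "t \<in> {0<..<1} - S" for t
  proof -
    have V: "?V t \<in> su" using S(2) t by (intro SU_velocity g(2)) auto
    have Yt: "Y t \<in> su" and gt: "g t \<in> SU" using su SU_path t by auto
    have "- \<Gamma> (g t) (?V t) (T' (Y t)) = T' (- \<Gamma> (g t) (?V t) (Y t))"
      using linear_on_suD(1)[OF connection_linear[OF gt V] Yt] comm[OF gt V Yt]
      by (simp add: T'(2) Yt linear_neg[OF T'(1)])
    then show ?thesis
      using bounded_linear.has_vector_derivative[OF bl S(3)[OF t]] by simp
  qed
  moreover have "continuous_on {0..1} (\<lambda>t. T' (Y t))"
    using Y unfolding parallel_along_def by (intro bounded_linear.continuous_on[OF bl]) blast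
  moreover have "\<forall>t\<in>{0..1}. T' (Y t) \<in> su"
    using su T'(2) linear_on_suD(1)[OF T] by simp
  ultimately have "parallel_along \<Gamma> g (\<lambda>t. T' (Y t))"
    unfolding parallel_along_def using S(1,2) by blast
  then show ?thesis using that T'(2) su by blast
qed

lemma parallel_unique:
  assumes "parallel_along \<Gamma> g Y" "parallel_along \<Gamma> g Z" "Y 0 = Z 0"
  shows "Y 1 = Z 1"
proof -
  have "linear_on_su (\<lambda>X :: 'm cmat. - X)"
    using subspace_neg[OF subspace_su] by (auto simp: linear_on_su_def)
  then obtain Z' where Z': "parallel_along \<Gamma> g Z'" "\<And>t. t \<in> {0..1} \<Longrightarrow> Z' t = - Z t"
    using parallel_map[OF assms(2), of uminus] linear_on_suD(4)[OF connection_linear] by metis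
  have "Y 1 + Z' 1 = 0"
    using parallel_zero[OF parallel_add[OF assms(1) Z'(1)], of 0 1] assms(3) Z'(2) by simp
  then show ?thesis using Z'(2)[of 1] by simp
qed

lemma transport_in_GL_H:
  assumes P: "P \<in> su \<rightarrow>\<^sub>E su"
    and tr: "\<And>v. v \<in> su \<Longrightarrow> \<exists>Y. parallel_along \<Gamma> g Y \<and> Y 0 = v \<and> Y 1 = P v"
  shows "P \<in> GL_H I J K"
proof -
  have P_eq: "P (Y 0) = Y 1" if Y: "parallel_along \<Gamma> g Y" for Y
  proof -
    have "Y 0 \<in> su" using Y by (auto simp: parallel_along_def)
    then obtain Z where Z: "parallel_along \<Gamma> g Z" "Z 0 = Y 0" "Z 1 = P (Y 0)" using tr by blast
    then show ?thesis using parallel_unique[OF Y Z(1)] by simp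
  qed
  have comm: "P (T v) = T (P v)" if v: "v \<in> su" and T: "linear_on_su T"
    "\<And>x A B. x \<in> SU \<Longrightarrow> A \<in> su \<Longrightarrow> B \<in> su \<Longrightarrow> \<Gamma> x A (T B) = T (\<Gamma> x A B)" for T v
  proof -
    obtain Y where Y: "parallel_along \<Gamma> g Y" "Y 0 = v" "Y 1 = P v" using tr[OF v] by blast
    obtain Z where "parallel_along \<Gamma> g Z" "\<And>t. t \<in> {0..1} \<Longrightarrow> Z t = T (Y t)"
      using parallel_map[OF Y(1) T] by blast
    then show ?thesis using P_eq[of Z] Y by simp
  qed
  have "linear_on_su P"
    unfolding linear_on_su_def
  proof (intro conjI ballI allI)
    show "P X \<in> su" if "X \<in> su" for X using P that by auto
    show "P (X + Y) = P X + P Y" if X: "X \<in> su" and Y: "Y \<in> su" for X Y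
    proof -
      obtain A where A: "parallel_along \<Gamma> g A" "A 0 = X" "A 1 = P X" using tr[OF X] by blast
      obtain B where B: "parallel_along \<Gamma> g B" "B 0 = Y" "B 1 = P Y" using tr[OF Y] by blast
      show ?thesis using P_eq[OF parallel_add[OF A(1) B(1)]] A B by simp
    qed
    show "P (c *\<^sub>R X) = c *\<^sub>R P X" if "X \<in> su" for c X
    proof (rule comm[OF that])
      show "linear_on_su (\<lambda>X :: 'm cmat. c *\<^sub>R X)"
        using subspace_scale[OF subspace_su] by (auto simp: linear_on_su_def algebra_simps)
      show "\<Gamma> x A (c *\<^sub>R B) = c *\<^sub>R \<Gamma> x A B" if "x \<in> SU" "A \<in> su" "B \<in> su" for x A B
        using linear_on_suD(3)[OF connection_linear[OF that(1,2)] that(3)] .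
    qed
  qed
  moreover have "bij_betw P su su"
  proof (rule linear_on_su_bij[OF \<open>linear_on_su P\<close>])
    fix X assume X: "X \<in> su" "P X = 0"
    then obtain Y where Y: "parallel_along \<Gamma> g Y" "Y 0 = X" "Y 1 = 0" using tr[OF X(1)] by auto
    then show "X = 0" using parallel_zero[OF Y(1), of 1 0] by simp
  qed
  moreover have "P (T X) = T (P X)" if "T \<in> {I, J, K}" "X \<in> su" for T X
    using that \<Gamma> hc_linear[OF hc] by (intro comm) (auto simp: obata_connection_def preserves_def)
  ultimately show ?thesis using P by (simp add: GL_H_def)
qed

lemma transport_invariant:
  assumes h: "subspace h" "h \<subseteq> su"
    and inv: "\<And>x A B. x \<in> SU \<Longrightarrow> A \<in> su \<Longrightarrow> B \<in> h \<Longrightarrow> \<Gamma> x A B \<in> h"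
    and Y: "parallel_along \<Gamma> g Y" "Y 0 \<in> h"
  shows "Y 1 \<in> h"
proof -
  obtain Q :: "'m cmat \<Rightarrow> 'm cmat" where Q: "linear Q" "\<And>x. Q x \<in> h" "\<And>x. x \<in> h \<Longrightarrow> Q x = x"
    using subspace_projection[OF h(1)] by blast
  define L where "L X = X - Q X" for X
  have L: "linear L"
    unfolding L_def by (intro linear_compose_sub linear_ident Q(1))
  obtain C where C: "0 < C"
    "\<forall>x\<in>SU. \<forall>X\<in>su. \<forall>Y\<in>su. norm (\<Gamma> x X Y) \<le> C * norm X * norm Y"
    by (rule obata_bounded[OF hc \<Gamma>])
  obtain M where M: "0 < M" "\<And>X. norm (L X) \<le> M * norm X"
    using linear_bounded_pos[OF L] by blast
  have "L (Y 1) = 0"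
  proof (rule parallel_kernel[OF Y(1) L, where C = "M * C"])
    fix x A B :: "'m cmat" assume x: "x \<in> SU" and A: "A \<in> su" and B: "B \<in> su"
    have QB: "Q B \<in> su" using Q(2) h(2) by blast
    have LB: "L B \<in> su" unfolding L_def by (rule subspace_diff[OF subspace_su B QB])
    have "\<Gamma> x A B = \<Gamma> x A (Q B) + \<Gamma> x A (L B)"
      using linear_on_suD(2)[OF connection_linear[OF x A] QB LB] by (simp add: L_def)
    moreover have "L (\<Gamma> x A (Q B)) = 0"
      using inv[OF x A Q(2)] Q(3) by (simp add: L_def)
    ultimately have "L (\<Gamma> x A B) = L (\<Gamma> x A (L B))"
      by (simp add: linear_add[OF L])
    also have "norm \<dots> \<le> M * norm (\<Gamma> x A (L B))" by (rule M(2))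
    also have "\<dots> \<le> M * (C * norm A * norm (L B))"
      using C(2)[rule_format, OF x A LB] M(1) by (intro mult_left_mono) auto
    finally show "norm (L (\<Gamma> x A B)) \<le> M * C * norm A * norm (L B)" by (simp add: mult.assoc)
  qed (use Y(2) Q(3) in \<open>auto simp: L_def\<close>)
  then have "Y 1 = Q (Y 1)" by (simp add: L_def)
  then show ?thesis using Q(2) by metis
qed

end

section \<open>A quaternionic transvection moving the block\<close>

text \<open>\<open>X \<mapsto> c X u - c (I X) I u - c (J X) J u - c (K X) K u\<close> is the quaternionic linearisation of a
  real functional \<open>c\<close>.\<close>

lemma GL_H_transvection:
  fixes I J K :: "'m::finite cmat \<Rightarrow> 'm cmat" and c :: "'m cmat \<Rightarrow> real"
  assumes hc: "hypercomplex_structure I J K" and c: "linear c" and u: "u \<in> su" and w: "w \<in> su"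
    and cu: "c u = 0" "c (I u) = 0" "c (J u) = 0" "c (K u) = 0"
    and cw: "c w = 1" "c (I w) = 0" "c (J w) = 0" "c (K w) = 0"
  obtains P where "P \<in> GL_H I J K" "P w = w + u"
proof -
  note lin = hc_linear[OF hc] and in_su = hc_in_su[OF hc] and mult = hc_mult[OF hc]
  define N where "N X = c X *\<^sub>R u - c (I X) *\<^sub>R I u - c (J X) *\<^sub>R J u - c (K X) *\<^sub>R K u" for X
  note cl = linear_add[OF c] linear_scale[OF c] linear_neg[OF c]
  have N_su: "N X \<in> su" if "X \<in> su" for X
    unfolding N_def using u in_su by (intro subspace_diff[OF subspace_su] subspace_scale[OF subspace_su]) auto
  have N: "linear_on_su N"
    unfolding linear_on_su_def
    by (intro conjI ballI allI) (simp_all add: N_su, simp_all add: N_def linear_on_suD[OF lin(1)]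
        linear_on_suD[OF lin(2)] linear_on_suD[OF lin(3)] cl algebra_simps)
  have T_comb: "T (N X) = c X *\<^sub>R T u - c (I X) *\<^sub>R T (I u) - c (J X) *\<^sub>R T (J u) - c (K X) *\<^sub>R T (K u)"
    if T: "linear_on_su T" for T X
    unfolding N_def using u in_su
    by (simp add: linear_on_suD[OF T] subspace_diff[OF subspace_su] subspace_scale[OF subspace_su])
  have comm: "N (I X) = I (N X)" "N (J X) = J (N X)" "N (K X) = K (N X)" if X: "X \<in> su" for X
    unfolding T_comb[OF lin(1)] T_comb[OF lin(2)] T_comb[OF lin(3)] 
    unfolding N_def by (simp_all add: mult X u cl)
  have Nu: "N u = 0" by (simp add: N_def cu)
  have NN: "N (N X) = 0" if "X \<in> su" for X
    unfolding T_comb[OF N] by (simp add: comm u Nu linear_on_suD(6)[OF lin(1)]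
        linear_on_suD(6)[OF lin(2)] linear_on_suD(6)[OF lin(3)])
  define P where "P = restrict (\<lambda>X. X + N X) su"
  have P_in: "P X \<in> su" if "X \<in> su" for X
    using subspace_add[OF subspace_su that N_su[OF that]] that by (simp add: P_def)
  have P: "linear_on_su P"
    unfolding linear_on_su_def
  proof (intro conjI ballI allI P_in)
    show "P (X + Y) = P X + P Y" if "X \<in> su" "Y \<in> su" for X Y
      using that subspace_add[OF subspace_su that] by (simp add: P_def linear_on_suD[OF N])
    show "P (c *\<^sub>R X) = c *\<^sub>R P X" if "X \<in> su" for c X
      using that subspace_scale[OF subspace_su that] by (simp add: P_def linear_on_suD[OF N] algebra_simps)
  qed
  moreover have "bij_betw P su su"
  proof (rule linear_on_su_bij[OF P])
    fix X assume X: "X \<in> su" "P X = 0"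
    then have X_eq: "X = - N X" by (simp add: P_def eq_neg_iff_add_eq_0)
    then have "N X = - N (N X)" using linear_on_suD(4)[OF N N_su[OF X(1)]] by simp
    then show "X = 0" using X_eq NN[OF X(1)] by simp
  qed
  moreover have "P (I X) = I (P X)" "P (J X) = J (P X)" "P (K X) = K (P X)" if "X \<in> su" for X
    using that in_su N_su by (simp_all add: P_def comm linear_on_suD lin)
  moreover have "P \<in> su \<rightarrow>\<^sub>E su" using P_in by (auto simp: P_def)
  ultimately have "P \<in> GL_H I J K" by (simp add: GL_H_def)
  moreover have "P w = w + u" using w by (simp add: P_def N_def cw)
  ultimately show ?thesis by (rule that)
qed

context joyce
begin

lemma holonomy_subset:
  assumes \<Gamma>: "obata_connection I J K \<Gamma>"
  shows "holonomy \<Gamma> \<subseteq> GL_H I J K"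
  using transport_in_GL_H[OF hc \<Gamma>] by (fastforce simp: holonomy_def)

lemma holonomy_invariant:
  assumes \<Gamma>: "obata_connection I J K \<Gamma>" and "P \<in> holonomy \<Gamma>" "v \<in> h"
  shows "P v \<in> h"
proof -
  obtain g where g: "piecewise_C1 g" "g ` {0..1} \<subseteq> SU"
    and tr: "\<And>v. v \<in> su \<Longrightarrow> \<exists>Y. parallel_along \<Gamma> g Y \<and> Y 0 = v \<and> Y 1 = P v"
    using assms(2) by (auto simp: holonomy_def)
  obtain Y where Y: "parallel_along \<Gamma> g Y" "Y 0 = v" "Y 1 = P v"
    using tr h_su assms(3) by blast
  have "Y 1 \<in> h"
    using transport_invariant[OF hc \<Gamma> g subspace_su_block h_su obata_invariant[OF \<Gamma>] Y(1)] Y(2) assms(3)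
    by blast
  then show ?thesis using Y by simp
qed

lemma holonomy_psubset:
  assumes \<Gamma>: "obata_connection I J K \<Gamma>" and k0: "0 < k" "k < n"
  shows "holonomy \<Gamma> \<subset> GL_H I J K"
proof -
  have n: "n \<in> {1..n}" "n \<in> {n-k+1..n}" and one: "1 \<in> {1..n}" "1 \<notin> {n-k+1..n}" and "1 \<noteq> n"
    using k0 by auto
  have inj: "inj_on e1 {1..n}" and ind: "independent (e1 ` {1..n})"
    using basis by (auto simp: is_basis_def)
  have "e1 n \<in> h" using e1_block n(2) by blast
  have "e1 1 \<notin> h"
  proof
    assume "e1 1 \<in> h"
    then have "e1 1 \<in> span (e1 ` {n-k+1..n})"
      by (intro torus_block_span[OF card k basis e1_block] e_mem one)
    also have "span (e1 ` {n-k+1..n}) \<subseteq> span (e1 ` {1..n} - {e1 1})"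
      using inj one by (intro span_mono) (auto dest!: inj_onD)
    finally show False using ind one by (auto simp: dependent_def)
  qed
  obtain c0 :: "'m cmat \<Rightarrow> real" where c0: "linear c0"
    "\<And>x. x \<in> e1 ` {1..n} \<Longrightarrow> c0 x = (if x = e1 n then 1 else 0)"
    using linear_independent_extend[OF ind, of "\<lambda>x. if x = e1 n then 1 else 0"] by blast
  define c where "c X = c0 (proj_b X)" for X
  have "linear c"
    unfolding c_def using linear_compose[OF linear_proj_b c0(1)] by (simp add: o_def)
  have cd: "c X = 0" if "i \<in> {1..n}" "X \<in> joyce_d i" for X i
    using that proj_b_d[of i X] linear_0[OF c0(1)] by (simp add: c_def)
  have ce: "c (e1 i) = (if i = n then 1 else 0)" if "i \<in> {1..n}" for i
    using proj_b_b[OF card e_mem(1)[OF that]] c0(2) that inj_on_eq_iff[OF inj that n(1)]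
    by (simp add: c_def)
  obtain P where P: "P \<in> GL_H I J K" "P (e1 n) = e1 n + e1 1"
  proof (rule GL_H_transvection[OF hc \<open>linear c\<close> e1_su[OF one(1)] e1_su[OF n(1)]])
    show "c (e1 1) = 0" "c (e1 n) = 1" using ce[OF one(1)] ce[OF n(1)] \<open>1 \<noteq> n\<close> by auto
    show "c (I (e1 1)) = 0" "c (J (e1 1)) = 0" "c (K (e1 1)) = 0"
      unfolding action[OF one(1)] using cd[OF one(1)] e_mem[OF one(1)] by auto
    show "c (I (e1 n)) = 0" "c (J (e1 n)) = 0" "c (K (e1 n)) = 0"
      unfolding action[OF n(1)] using cd[OF n(1)] e_mem[OF n(1)] by auto
  qed
  have "P \<notin> holonomy \<Gamma>"
  proof
    assume "P \<in> holonomy \<Gamma>"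
    then have "e1 n + e1 1 \<in> h"
      using holonomy_invariant[OF \<Gamma> _ \<open>e1 n \<in> h\<close>] P(2) by metis
    then have "e1 n + e1 1 - e1 n \<in> h"
      using \<open>e1 n \<in> h\<close> by (rule subspace_diff[OF subspace_su_block])
    then show False using \<open>e1 1 \<notin> h\<close> by simp
  qed
  then show ?thesis using holonomy_subset[OF \<Gamma>] P(1) by blast
qed

end

theorem theorem4p8:
  fixes n k :: nat
    and E e1 e2 e3 e4 :: "nat \<Rightarrow> 'm::{finite,linorder} cmat"
    and a :: "nat \<Rightarrow> nat \<Rightarrow> real"
    and I J K :: "'m cmat \<Rightarrow> 'm cmat"
    and \<Gamma> :: "'m cmat \<Rightarrow> 'm cmat \<Rightarrow> 'm cmat \<Rightarrow> 'm cmat"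
  assumes "CARD('m) = 2 * n + 1" and "1 < n" and "k \<in> {1..n-1}"
    and "is_basis (joyce_b n) {1..n} E"
    and "\<And>j. j \<in> {1..n} \<Longrightarrow> E j \<in> su_block (2*n + 3 - 2*j)"
    and "GL_real n a"
    and "\<And>j i. j \<in> {1..n-k} \<Longrightarrow> i \<in> {n-k+1..n} \<Longrightarrow> a j i = 0"
    and "\<And>i. i \<in> {1..n} \<Longrightarrow> e1 i = (\<Sum>j=1..n. a j i *\<^sub>R E j)"
    and "joyce_hypercomplex n e1 e2 e3 e4 I J K"
    and "obata_connection I J K \<Gamma>"
  shows
    "(\<forall>i\<in>{n-k+1..n}. e1 i = (\<Sum>j=n-k+1..n. a j i *\<^sub>R E j) \<and> e1 i \<in> su_block (2*k+1)) \<and>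
     is_direct_sum (su_block (2*k+1)) ({n-k+1..n} \<times> {..<3})
       (\<lambda>(i, s). [span {e1 i}, joyce_d i, joyce_f i] ! s) \<and>
     (\<forall>Y\<in>su_block (2*k+1). I Y \<in> su_block (2*k+1) \<and> J Y \<in> su_block (2*k+1) \<and> K Y \<in> su_block (2*k+1)) \<and>
     (\<forall>X\<in>su. \<forall>Y\<in>su_block (2*k+1). \<exists>Z\<in>su_block (2*k+1). \<forall>x\<in>SU. \<Gamma> x X Y = Z) \<and>
     holonomy \<Gamma> \<subset> GL_H I J K"
proof -
  have kn: "0 < k" "k < n" "k \<le> n" using assms(2,3) by auto
  have e1: "e1 i = (\<Sum>j=n-k+1..n. a j i *\<^sub>R E j)" if i: "i \<in> {n-k+1..n}" for i
  proof -
    have "e1 i = (\<Sum>j=1..n. a j i *\<^sub>R E j)" using assms(8)[of i] i by simp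
    also have "\<dots> = (\<Sum>j=n-k+1..n. a j i *\<^sub>R E j)"
      using assms(7) i by (intro sum.mono_neutral_right) auto
    finally show ?thesis .
  qed
  have e1_block: "e1 i \<in> su_block (2*k+1)" if i: "i \<in> {n-k+1..n}" for i
    unfolding e1[OF i]
  proof (intro subspace_sum[OF subspace_su_block] subspace_scale[OF subspace_su_block])
    fix j assume j: "j \<in> {n-k+1..n}"
    then have "E j \<in> su_block (2*n + 3 - 2*j)" using assms(5)[of j] by simp
    moreover have "2*n + 3 - 2*j \<le> 2*k+1" using j kn by auto
    ultimately show "E j \<in> su_block (2*k+1)" using su_block_mono by blast
  qed
  interpret joyce n k e1 e2 e3 e4 I J K
    by unfold_locales (fact assms(1) kn(3) e1_block assms(9))+
  have inv: "\<exists>Z\<in>h. \<forall>x\<in>SU. \<Gamma> x X Y = Z" if X: "X \<in> su" and Y: "Y \<in> h" for X Y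
  proof (intro bexI[of _ "obata I J K X Y"] ballI)
    have Ysu: "Y \<in> su" using Y h_su by blast
    show eq: "\<Gamma> x X Y = obata I J K X Y" if "x \<in> SU" for x
      by (rule obata_formula[OF hc assms(10) that X Ysu])
    show "obata I J K X Y \<in> h"
      using obata_invariant[OF assms(10) one_in_SU X Y] eq[OF one_in_SU] by simp
  qed
  show ?thesis
    using e1 e1_block block_direct_sum[OF card kn(3) basis e1_block] h_invariant inv
      holonomy_psubset[OF assms(10) kn(1,2)]
    by (intro conjI ballI) auto
qed

end
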